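(* For integers $n\ge j\ge1$ and $m\ge1$, the number $X_{n,j}$ of descendants of node $j$ in a random ordered increasing $k$-tree of size $n$ satisfies \[ \mathbb{P}\{X_{n,j}=m\}=\frac{\binom{m-1-\frac{1}{k+1}}{m-1}\binom{n-m-1+\frac{2}{k+1}}{n-m-j+1}}{\binom{n-\frac{k}{k+1}}{n-j}}. \] Moreover, as $n\to\infty$: (i) For fixed $j\ge1$: $X_{n,j}/n$ converges in distribution to a Beta$(\frac{k}{k+1},\,j-1+\frac{2}{k+1})$ random variable $X_j$, whose moments are $\mathbb{E}(X_j^s)=\binom{s-\frac1{k+1}}{s}\big/\binom{s+j-\frac{k}{k+1}}{s}$, $s\ge0$. (ii) If $j=j(n)\to\infty$ with $j=o(n)$: $\frac jn X_{n,j}$ converges in distribution to a Gamma$(\frac{k}{k+1},1)$ random variable $X$, with $\mathbb{E}(X^s)=s!\binom{s-\frac1{k+1}}{s}$, $s\ge0$. (iii) If $j=j(n)\to\infty$ with $j\sim\rho n$ for fixed $0<\rho<1$: $X_{n,j}-1$ converges in distribution to a random variable $X_\rho$ with $\mathbb{P}\{X_\rho=m\}=\binom{m-\frac1{k+1}}{m}\rho^{\frac{k}{k+1}}(1-\rho)^m$, $m\ge0$ (negative binomial law). (iv) If $j=j(n)\to\infty$ with $n-j=o(n)$: $\mathbb{P}\{X_{n,j}=1\}\to1$.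
   Context: Fix an integer $k\ge1$. An ordered increasing $k$-tree of size $n\ge0$ is built as follows. Start with the root-clique $K_0$: $k$ pairwise adjacent vertices labelled $0_1,\dots,0_k$ (the root nodes; each label $0_\ell$ has value $0$). For $j=1,\dots,n$ in turn, node $j$ is inserted by choosing a currently existing $k$-clique $K$ and attaching $j$ to it, i.e. adding edges from $j$ to all $k$ vertices of $K$; $j$ is then a child of $K$ and the vertices of $K$ are the parents of $j$. The $k$-cliques available for attachment are the root-clique and, for every previously inserted node $x$ attached to a clique $K'$, the $k$ cliques $\{x\}\cup(K'\setminus\{w\})$, $w\in K'$. The children of each $k$-clique are linearly ordered: if $K$ currently has $d^+(K)$ children, there are $d^+(K)+1$ positions at which the new child may be placed, and the choice of position is part of the structure. Thus there are $1+(k+1)(j-1)$ ways to insert node $j$, and distinct sequences of choices give distinct trees. A random ordered increasing $k$-tree of size $n$ is one chosen uniformly among all of them; equivalently, it is produced by the process in which node $n$ is attached to the clique $K$ with probability $\frac{d^+(K)+1}{1+(k+1)(n-1)}$ (and a uniformly random position among the $d^+(K)+1$). A node $w$ is a descendant of $u$ if $w=u$ or some parent of $w$ is a descendant of $u$ (so $u$ counts as its own descendant). For real $x$ and integer $m\ge0$, $\binom{x}{m}=x(x-1)\cdots(x-m+1)/m!$, and $\binom{x}{m}=0$ for $m<0$. *)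

theory Defs
  imports "HOL-Probability.Probability"
begin

text \<open>Vertices: root nodes 0_1..0_k are RootV 1..RootV k; node j is NodeV j.\<close>
datatype vertex = RootV nat | NodeV nat

text \<open>A tree of size n is the list of its n insertion choices; choice number j
  (list index j-1) records the k-clique (as a vertex set) node j was attached to
  and the position (0..d) among the d+1 possible positions in that clique's
  ordered list of children.\<close>
type_synonym choice = "vertex set \<times> nat"

definition root_clique :: "nat \<Rightarrow> vertex set" where
  "root_clique k = RootV ` {1..k}"

definition par :: "choice list \<Rightarrow> nat \<Rightarrow> vertex set" where
  "par tr x = fst (tr ! (x - 1))"

definition avail :: "nat \<Rightarrow> choice list \<Rightarrow> vertex set set" where
  "avail k tr = insert (root_clique k)
     {insert (NodeV x) (par tr x - {w}) | x w. x \<in> {1..length tr} \<and> w \<in> par tr x}"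

definition outdeg :: "choice list \<Rightarrow> vertex set \<Rightarrow> nat" where
  "outdeg tr K = card {x \<in> {1..length tr}. par tr x = K}"

fun ktrees :: "nat \<Rightarrow> nat \<Rightarrow> choice list set" where
  "ktrees k 0 = {[]}"
| "ktrees k (Suc n) = {tr @ [(K, p)] | tr K p.
      tr \<in> ktrees k n \<and> K \<in> avail k tr \<and> p \<le> outdeg tr K}"

inductive_set desc :: "choice list \<Rightarrow> vertex \<Rightarrow> vertex set" for tr u where
  self: "u \<in> desc tr u"
| step: "x \<in> {1..length tr} \<Longrightarrow> v \<in> par tr x \<Longrightarrow> v \<in> desc tr u \<Longrightarrow> NodeV x \<in> desc tr u"

definition Xlaw :: "nat \<Rightarrow> nat \<Rightarrow> nat \<Rightarrow> nat pmf" where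
  "Xlaw k n j = map_pmf (\<lambda>tr. card (desc tr (NodeV j))) (pmf_of_set (ktrees k n))"

definition gbinom :: "real \<Rightarrow> int \<Rightarrow> real" where
  "gbinom x m = (if m < 0 then 0 else x gchoose (nat m))"

definition beta_density :: "real \<Rightarrow> real \<Rightarrow> real \<Rightarrow> real" where
  "beta_density a b x = (if 0 < x \<and> x < 1 then x powr (a - 1) * (1 - x) powr (b - 1) / Beta a b else 0)"

definition gamma_density :: "real \<Rightarrow> real \<Rightarrow> real \<Rightarrow> real" where
  "gamma_density a \<theta> x = (if 0 < x then x powr (a - 1) * exp (- x / \<theta>) / (Gamma a * \<theta> powr a) else 0)"

definition Beta_distr :: "real \<Rightarrow> real \<Rightarrow> real measure" where
  "Beta_distr a b = density lborel (\<lambda>x. ennreal (beta_density a b x))"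

definition Gamma_distr :: "real \<Rightarrow> real \<Rightarrow> real measure" where
  "Gamma_distr a \<theta> = density lborel (\<lambda>x. ennreal (gamma_density a \<theta> x))"

definition negbin_pm :: "nat \<Rightarrow> real \<Rightarrow> nat \<Rightarrow> real" where
  "negbin_pm k \<rho> m = ((real m - 1 / (k + 1)) gchoose m) * \<rho> powr (k / (k + 1)) * (1 - \<rho>) ^ m"

definition negbin_distr :: "nat \<Rightarrow> real \<Rightarrow> real measure" where
  "negbin_distr k \<rho> = distr (density (count_space UNIV) (\<lambda>m::nat. ennreal (negbin_pm k \<rho> m))) borel real"

end

theory Submission
  imports Defs
begin

text \<open>
  Call a pair of an available clique and a position in its list of children a slot. When the
  descendant set \<open>D\<close> of node \<open>j\<close> grows by one node, the clique it is attached to gains one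
  position and \<open>k\<close> new cliques meeting \<open>D\<close> appear, so exactly \<open>(k + 1) * card D - 1\<close> of the
  \<open>1 + (k + 1) * n\<close> slots make the next node a descendant. Hence \<open>card D - 1\<close> evolves as a Polya
  urn, and with \<open>a = k / (k + 1)\<close> and \<open>b = j - 1 + 2 / (k + 1)\<close> its law is beta-binomial with
  \<open>n - j\<close> draws.

  A beta-binomial variable is a binomial one whose success probability \<open>Y\<close> is Beta distributed;
  by the variance of the Bernstein weights it stays close to \<open>(n - j) * Y\<close>, which reduces (i) and
  (ii) to limits of rescaled Beta laws. There the density of \<open>b * Y\<close> converges to the Gamma
  density by dominated convergence, and the total masses give
  \<open>b powr a * Beta a b \<longlonglongrightarrow> Gamma a\<close>. This asymptotics yields the point mass at 0 in (iii), and
  the ratio of consecutive point masses yields the others.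
\<close>

section \<open>Insertion slots and descendants\<close>

definition verts :: "nat \<Rightarrow> nat \<Rightarrow> vertex set" where
  "verts k n = RootV ` {1..k} \<union> NodeV ` {1..n}"

text \<open>The predicate \<open>Q\<close> restricts the cliques, so that one definition covers all
  insertion choices as well as those that enlarge a given descendant set.\<close>

definition slots :: "nat \<Rightarrow> choice list \<Rightarrow> (vertex set \<Rightarrow> bool) \<Rightarrow> choice set" where
  "slots k tr Q = (SIGMA K:{K \<in> avail k tr. Q K}. {..outdeg tr K})"

definition new_clique :: "nat \<Rightarrow> vertex set \<Rightarrow> vertex \<Rightarrow> vertex set" where
  "new_clique x K w = insert (NodeV x) (K - {w})"

section \<open>Vertices, available cliques and parents\<close>

lemma finite_verts [simp]: "finite (verts k n)"
  by (simp add: verts_def)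

lemma NodeV_in_verts_iff [simp]: "NodeV x \<in> verts k n \<longleftrightarrow> 1 \<le> x \<and> x \<le> n"
  by (auto simp: verts_def)

lemma verts_mono: "m \<le> n \<Longrightarrow> verts k m \<subseteq> verts k n"
  by (auto simp: verts_def)

lemma par_snoc_old: "1 \<le> x \<Longrightarrow> x \<le> length tr \<Longrightarrow> par (tr @ [c]) x = par tr x"
  by (auto simp: par_def nth_append)

lemma par_snoc_new [simp]: "par (tr @ [c]) (Suc (length tr)) = fst c"
  by (simp add: par_def)

text \<open>Appending a choice leaves the parents of all earlier nodes unchanged, so the only
  additional cliques are those created by the last node.\<close>

lemma avail_snoc:
  "avail k (tr @ [c]) = avail k tr \<union> new_clique (Suc (length tr)) (fst c) ` fst c"
proof -
  have "{insert (NodeV x) (par (tr @ [c]) x - {w}) | x w. x \<in> {1..length (tr @ [c])} \<and> w \<in> par (tr @ [c]) x}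
    = (\<Union>x\<in>{1..length (tr @ [c])}. new_clique x (par (tr @ [c]) x) ` par (tr @ [c]) x)"
    unfolding new_clique_def by blast
  also have "\<dots> = (\<Union>x\<in>{1..length tr}. new_clique x (par (tr @ [c]) x) ` par (tr @ [c]) x)
      \<union> new_clique (Suc (length tr)) (fst c) ` fst c"
    by (simp add: atLeastAtMostSuc_conv Un_commute)
  also have "(\<Union>x\<in>{1..length tr}. new_clique x (par (tr @ [c]) x) ` par (tr @ [c]) x)
      = (\<Union>x\<in>{1..length tr}. new_clique x (par tr x) ` par tr x)"
    by (intro SUP_cong refl) (simp add: par_snoc_old)
  also have "\<dots> = {insert (NodeV x) (par tr x - {w}) | x w. x \<in> {1..length tr} \<and> w \<in> par tr x}"
    unfolding new_clique_def by blast
  finally show ?thesis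
    unfolding avail_def by simp
qed

lemma length_ktrees: "tr \<in> ktrees k n \<Longrightarrow> length tr = n"
  by (induction n arbitrary: tr) auto

text \<open>The condition on parents is a hypothesis, and not derived from \<open>ktrees\<close>,
  because \<open>par_wf\<close> uses this lemma inside the very induction that establishes the
  condition.\<close>

lemma avail_wf:
  assumes "1 \<le> k"
    and "\<And>x. 1 \<le> x \<Longrightarrow> x \<le> length tr \<Longrightarrow> par tr x \<subseteq> verts k (x - 1) \<and> card (par tr x) = k"
    and K: "K \<in> avail k tr"
  shows "K \<subseteq> verts k (length tr) \<and> card K = k"
proof -
  consider "K = root_clique k"
    | x w where "1 \<le> x" "x \<le> length tr" "w \<in> par tr x" "K = insert (NodeV x) (par tr x - {w})"
    using K by (auto simp: avail_def)
  then show ?thesis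
  proof cases
    case 1
    then show ?thesis
      by (auto simp: root_clique_def verts_def card_image inj_on_def)
  next
    case (2 x w)
    have p: "par tr x \<subseteq> verts k (x - 1)" "card (par tr x) = k"
      using assms(2)[OF 2(1,2)] by auto
    have "verts k (x - 1) \<subseteq> verts k (length tr)"
      using 2 by (intro verts_mono) auto
    moreover have "NodeV x \<notin> par tr x"
      using p(1) 2(1) by (auto dest!: subsetD)
    moreover have "finite (par tr x)"
      using p(1) finite_subset finite_verts by blast
    ultimately show ?thesis
      using 2 p assms(1) by auto
  qed
qed

lemma par_wf:
  assumes "1 \<le> k" "tr \<in> ktrees k n" "1 \<le> x" "x \<le> n"
  shows "par tr x \<subseteq> verts k (x - 1) \<and> card (par tr x) = k"
  using assms(2-)
proof (induction n arbitrary: tr x)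
  case (Suc n)
  then obtain t K p where tr: "tr = t @ [(K, p)]" "t \<in> ktrees k n" "K \<in> avail k t"
    by auto
  have len: "length t = n" using tr(2) by (rule length_ktrees)
  show ?case
  proof (cases "x \<le> n")
    case True
    then show ?thesis
      using Suc tr(1,2) len by (simp add: par_snoc_old)
  next
    case False
    then have x: "x = Suc (length t)" using Suc.prems len by simp
    have "par tr x = K"
      unfolding x tr(1) by simp
    then show ?thesis
      using avail_wf[OF assms(1) _ tr(3)] Suc.IH[OF tr(2)] x len by simp
  qed
qed simp

lemma clique_wf:
  assumes "1 \<le> k" "tr \<in> ktrees k n" "K \<in> avail k tr"
  shows "K \<subseteq> verts k n" "card K = k"
  using avail_wf[OF assms(1) _ assms(3)] par_wf[OF assms(1,2)] length_ktrees[OF assms(2)]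
  by auto

lemma finite_avail:
  assumes "1 \<le> k" "tr \<in> ktrees k n"
  shows "finite (avail k tr)"
  by (rule finite_subset[of _ "Pow (verts k n)"]) (use clique_wf(1)[OF assms] in auto)

section \<open>Slot counts and their change under an insertion\<close>

lemma finite_slots:
  assumes "1 \<le> k" "tr \<in> ktrees k n"
  shows "finite (slots k tr Q)"
  unfolding slots_def using finite_avail[OF assms] by auto

lemma card_slots:
  assumes "1 \<le> k" "tr \<in> ktrees k n"
  shows "card (slots k tr Q) = (\<Sum>K | K \<in> avail k tr \<and> Q K. Suc (outdeg tr K))"
  unfolding slots_def using finite_avail[OF assms] by (subst card_SigmaI) auto

lemma outdeg_snoc:
  "outdeg (tr @ [c]) K = outdeg tr K + (if K = fst c then 1 else 0)"
proof -
  have "{x \<in> {1..length (tr @ [c])}. par (tr @ [c]) x = K}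
      = {x \<in> {1..length tr}. par tr x = K} \<union> (if K = fst c then {Suc (length tr)} else {})"
    (is "?A = ?B")
  proof (rule set_eqI)
    fix x
    show "x \<in> ?A \<longleftrightarrow> x \<in> ?B"
    proof (cases "x = Suc (length tr)")
      case False
      then have "x \<in> {1..length (tr @ [c])} \<longleftrightarrow> x \<in> {1..length tr}"
        by simp linarith
      moreover have "par (tr @ [c]) x = par tr x" if "x \<in> {1..length tr}"
        using that by (intro par_snoc_old) simp_all
      ultimately have "x \<in> ?A \<longleftrightarrow> x \<in> {1..length tr} \<and> par tr x = K"
        unfolding mem_Collect_eq by metis
      then show ?thesis
        using False by (simp only: Un_iff mem_Collect_eq) simp
    qed simp
  qed
  then show ?thesis
    unfolding outdeg_def by (simp only:) simp
qed

text \<open>All node parents of \<open>x\<close> have index below \<open>x\<close>, so nothing in a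
  tree of size \<open>n\<close> is attached to a clique containing the node \<open>Suc n\<close>
  that is about to be inserted.\<close>

lemma outdeg_new:
  assumes "1 \<le> k" "tr \<in> ktrees k n" "NodeV (Suc n) \<in> K"
  shows "outdeg tr K = 0"
proof -
  have "par tr x \<noteq> K" if "1 \<le> x" "x \<le> n" for x
  proof
    assume "par tr x = K"
    then have "NodeV (Suc n) \<in> verts k (x - 1)"
      using par_wf[OF assms(1,2) that] assms(3) by blast
    then show False
      using that by simp
  qed
  then have "{x \<in> {1..length tr}. par tr x = K} = {}"
    unfolding length_ktrees[OF assms(2)] by simp
  then show ?thesis
    by (simp only: outdeg_def card.empty)
qed

text \<open>Old cliques keep their positions, the chosen clique gains one, and each new clique
  starts with exactly one. There are two predicates because the descendant set may itself grow with
  the insertion; they have to agree on the old cliques only.\<close>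

lemma card_slots_snoc:
  assumes k: "1 \<le> k" and tr: "tr \<in> ktrees k n" and c: "c \<in> slots k tr (\<lambda>_. True)"
    and old: "\<And>K. K \<in> avail k tr \<Longrightarrow> Q' K = Q K"
  shows "card (slots k (tr @ [c]) Q') = card (slots k tr Q) + (if Q (fst c) then 1 else 0)
    + card {w \<in> fst c. Q' (new_clique (Suc n) (fst c) w)}"
proof -
  define K where "K = fst c"
  let ?new = "new_clique (Suc n) K"
  have K: "K \<in> avail k tr" and p: "snd c \<le> outdeg tr K"
    using c by (auto simp: slots_def K_def)
  have len: "length tr = n" using tr by (rule length_ktrees)
  have tr': "tr @ [c] \<in> ktrees k (Suc n)"
    using tr K p by (auto simp: K_def intro!: exI[of _ tr] exI[of _ "fst c"] exI[of _ "snd c"])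
  have finK: "finite K"
    using clique_wf[OF k tr K] finite_subset finite_verts by blast
  have NK: "NodeV (Suc n) \<notin> K'" if "K' \<in> avail k tr" for K'
    using clique_wf(1)[OF k tr that] by (auto dest!: subsetD)
  \<comment> \<open>Different omitted vertices yield different new cliques, so these can be counted
    by the omitted vertex.\<close>
  have inj: "inj_on ?new K"
  proof (rule inj_onI)
    fix v w assume vw: "v \<in> K" "w \<in> K" "?new v = ?new w"
    then have "K - {v} = K - {w}"
      using NK[OF K] unfolding new_clique_def by (metis Diff_iff insert_ident)
    then show "v = w"
      using vw by blast
  qed
  have split: "{K' \<in> avail k (tr @ [c]). Q' K'} = {K' \<in> avail k tr. Q K'} \<union> ?new ` {w \<in> K. Q' (?new w)}"
    using old by (auto simp: avail_snoc len K_def)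
  have "card (slots k (tr @ [c]) Q') = (\<Sum>K' | K' \<in> avail k (tr @ [c]) \<and> Q' K'. Suc (outdeg (tr @ [c]) K'))"
    by (rule card_slots[OF k tr'])
  also have "\<dots> = (\<Sum>K' | K' \<in> avail k tr \<and> Q K'. Suc (outdeg (tr @ [c]) K'))
      + (\<Sum>K' \<in> ?new ` {w \<in> K. Q' (?new w)}. Suc (outdeg (tr @ [c]) K'))"
    unfolding split
    by (rule sum.union_disjoint)
       (use finite_avail[OF k tr] finK NK in \<open>auto simp: new_clique_def\<close>)
  also have "(\<Sum>K' \<in> ?new ` {w \<in> K. Q' (?new w)}. Suc (outdeg (tr @ [c]) K'))
      = (\<Sum>w \<in> {w \<in> K. Q' (?new w)}. Suc (outdeg (tr @ [c]) (?new w)))"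
    by (subst sum.reindex) (use inj in \<open>auto simp: inj_on_def\<close>)
  also have "\<dots> = (\<Sum>w \<in> {w \<in> K. Q' (?new w)}. 1)"
  proof (rule sum.cong)
    fix w assume "w \<in> {w \<in> K. Q' (?new w)}"
    have "NodeV (Suc n) \<in> ?new w" by (simp add: new_clique_def)
    then have "outdeg tr (?new w) = 0" "?new w \<noteq> fst c"
      using outdeg_new[OF k tr] NK[OF K] by (auto simp: K_def)
    then show "Suc (outdeg (tr @ [c]) (?new w)) = 1"
      by (simp add: outdeg_snoc)
  qed simp
  also have "(\<Sum>K' | K' \<in> avail k tr \<and> Q K'. Suc (outdeg (tr @ [c]) K'))
      = (\<Sum>K' | K' \<in> avail k tr \<and> Q K'. Suc (outdeg tr K')) + (if Q K then 1 else 0)"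
  proof -
    have "(\<Sum>K' | K' \<in> avail k tr \<and> Q K'. if K' = K then 1 else 0::nat) = (if Q K then 1 else 0)"
      using finite_avail[OF k tr] K by (subst sum.delta) auto
    then show ?thesis
      by (simp only: outdeg_snoc K_def[symmetric] add_Suc[symmetric] sum.distrib)
  qed
  also have "(\<Sum>K' | K' \<in> avail k tr \<and> Q K'. Suc (outdeg tr K')) = card (slots k tr Q)"
    by (rule card_slots[OF k tr, symmetric])
  finally show ?thesis
    by (simp add: K_def)
qed

section \<open>Descendant sets and the slots that touch them\<close>

lemma desc_eq_singleton:
  assumes "\<And>x. x \<in> {1..length tr} \<Longrightarrow> u \<notin> par tr x"
  shows "desc tr u = {u}"
proof -
  have "v = u" if "v \<in> desc tr u" for v
    using that by induction (use assms in auto)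
  then show ?thesis
    by (auto intro: desc.self)
qed

lemma desc_subset_verts:
  assumes "tr \<in> ktrees k n" "u \<in> verts k n"
  shows "desc tr u \<subseteq> verts k n"
proof
  fix v assume "v \<in> desc tr u"
  then show "v \<in> verts k n"
    by induction (use assms length_ktrees in auto)
qed

text \<open>A freshly inserted node is nobody's parent, so no older node changes its status; the new
  node is a descendant exactly if one of its parents is.\<close>

lemma desc_snoc:
  assumes k: "1 \<le> k" and tr: "tr \<in> ktrees k n" and K: "K \<in> avail k tr" and u: "u \<in> verts k n"
  shows "desc (tr @ [(K, p)]) u =
    desc tr u \<union> (if K \<inter> desc tr u = {} then {} else {NodeV (Suc n)})"
    (is "?L = ?R")
proof
  have len: "length tr = n" using tr by (rule length_ktrees)
  have sub: "v \<in> ?L" if "v \<in> desc tr u" for v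
    using that
  proof induction
    case (step x v)
    show ?case
      by (rule desc.step[of x _ v]) (use step in \<open>auto simp: par_snoc_old\<close>)
  qed (rule desc.self)
  show "?R \<subseteq> ?L"
  proof
    fix v assume "v \<in> ?R"
    then consider "v \<in> desc tr u" | w where "w \<in> K" "w \<in> desc tr u" "v = NodeV (Suc n)"
      by (auto split: if_splits)
    then show "v \<in> ?L"
    proof cases
      case (2 w)
      show ?thesis
        unfolding 2 by (rule desc.step[of _ _ w]) (use 2 sub len par_snoc_new[of tr "(K,p)"] in auto)
    qed (rule sub)
  qed
  have Dn: "NodeV (Suc n) \<notin> desc tr u"
    using desc_subset_verts[OF tr u] by (auto dest!: subsetD)
  show "?L \<subseteq> ?R"
  proof
    fix v assume "v \<in> ?L"
    then show "v \<in> ?R"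
    proof induction
      case self
      then show ?case by (auto intro: desc.self)
    next
      case (step x v)
      \<comment> \<open>This rules out that the parent \<open>v\<close> from the induction is the
        new node, so \<open>v\<close> was a descendant before the insertion.\<close>
      have nv: "NodeV (Suc n) \<notin> par (tr @ [(K, p)]) x"
      proof (cases "x \<le> n")
        case True
        then have "par (tr @ [(K, p)]) x \<subseteq> verts k (x - 1)"
          using par_wf[OF k tr, of x] step(1) len by (simp add: par_snoc_old)
        then show ?thesis using True by (auto dest!: subsetD)
      next
        case False
        then have "x = Suc (length tr)" using step len by simp
        then show ?thesis
          using clique_wf(1)[OF k tr K] by (auto dest!: subsetD)
      qed
      then have v: "v \<in> desc tr u"
        using step by (auto split: if_splits)
      show ?case
      proof (cases "x \<le> n")
        case True
        then show ?thesis
          using step(1,2) v len by (auto simp: par_snoc_old intro: desc.step)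
      next
        case False
        then have "x = Suc (length tr)" using step len by simp
        then show ?thesis
          using step(2) v len by auto
      qed
    qed
  qed
qed

text \<open>Every insertion adds one position at the chosen clique and \<open>k\<close> new cliques
  with one position each.\<close>

lemma card_all_slots:
  assumes "1 \<le> k" "tr \<in> ktrees k n"
  shows "card (slots k tr (\<lambda>_. True)) = 1 + (k + 1) * n"
  using assms(2)
proof (induction n arbitrary: tr)
  case 0
  then have "avail k tr = {root_clique k}" "outdeg tr (root_clique k) = 0"
    by (auto simp: avail_def outdeg_def)
  then show ?case
    using card_slots[OF assms(1) 0] by simp
next
  case (Suc n)
  then obtain t K p where tr: "tr = t @ [(K, p)]" "t \<in> ktrees k n" "K \<in> avail k t" "p \<le> outdeg t K"
    by auto
  then have "(K, p) \<in> slots k t (\<lambda>_. True)"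
    by (auto simp: slots_def)
  from card_slots_snoc[OF assms(1) tr(2) this, of "\<lambda>_. True" "\<lambda>_. True"]
  show ?case
    using Suc.IH[OF tr(2)] clique_wf[OF assms(1) tr(2,3)] tr(1) by simp
qed

text \<open>Node \<open>j\<close> starts with the \<open>k\<close> cliques it creates. A later
  descendant adds one position at a clique meeting the set and \<open>k\<close> cliques that contain
  the descendant itself. A later non-descendant adds nothing, as its new cliques avoid the set. The
  \<open>+ 1\<close> on the left avoids truncated subtraction.\<close>

lemma card_desc_slots:
  assumes k: "1 \<le> k" and "tr \<in> ktrees k n" "1 \<le> j" "j \<le> n"
  shows "card (slots k tr (\<lambda>K. K \<inter> desc tr (NodeV j) \<noteq> {})) + 1 = (k + 1) * card (desc tr (NodeV j))"
  using assms(2,4)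
proof (induction n arbitrary: tr)
  case 0
  then show ?case using assms(3) by simp
next
  case (Suc n)
  then obtain t K p where tr: "tr = t @ [(K, p)]" "t \<in> ktrees k n" "K \<in> avail k t" "p \<le> outdeg t K"
    by auto
  have c: "(K, p) \<in> slots k t (\<lambda>_. True)"
    using tr by (auto simp: slots_def)
  have len: "length t = n" using tr(2) by (rule length_ktrees)
  have NK: "NodeV (Suc n) \<notin> K'" if "K' \<in> avail k t" for K'
    using clique_wf(1)[OF k tr(2) that] by (auto dest!: subsetD)
  note snoc = card_slots_snoc[OF k tr(2) c]
  show ?case
  proof (cases "j = Suc n")
    case True
    have D: "desc tr (NodeV j) = {NodeV j}"
    proof (rule desc_eq_singleton)
      fix x assume "x \<in> {1..length tr}"
      then show "NodeV j \<notin> par tr x"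
        using par_wf[OF k Suc.prems(1), of x] length_ktrees[OF Suc.prems(1)] True
        by (auto dest!: subsetD)
    qed
    \<comment> \<open>No older clique contains \<open>NodeV j\<close>, hence the constantly false
      predicate on the old tree, while all \<open>k\<close> new cliques contain it.\<close>
    have "card (slots k (t @ [(K, p)]) (\<lambda>K. K \<inter> {NodeV j} \<noteq> {})) = card (slots k t (\<lambda>_. False)) + k"
      by (subst snoc[of _ "\<lambda>_. False"])
         (use True NK clique_wf[OF k tr(2,3)] in \<open>auto simp: new_clique_def\<close>)
    then show ?thesis
      unfolding D unfolding tr(1) by (simp add: slots_def)
  next
    case False
    then have j: "j \<le> n" using Suc.prems by simp
    define D where "D = desc t (NodeV j)"
    have "NodeV j \<in> verts k n" using j assms(3) by simp
    then have D': "desc tr (NodeV j) = D \<union> (if K \<inter> D = {} then {} else {NodeV (Suc n)})"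
      and Dv: "D \<subseteq> verts k n"
      unfolding tr(1) D_def
      by (intro desc_snoc[OF k tr(2,3)] desc_subset_verts[OF tr(2)]; assumption)+
    have finD: "finite D" using Dv finite_subset finite_verts by blast
    have ND: "NodeV (Suc n) \<notin> D" using Dv by (auto dest!: subsetD)
    have IH: "card (slots k t (\<lambda>K. K \<inter> D \<noteq> {})) + 1 = (k + 1) * card D"
      using Suc.IH[OF tr(2) j] by (simp add: D_def)
    show ?thesis
    proof (cases "K \<inter> D = {}")
      case True
      then have D'': "desc tr (NodeV j) = D" using D' by simp
      have "card (slots k (t @ [(K, p)]) (\<lambda>K. K \<inter> D \<noteq> {})) = card (slots k t (\<lambda>K. K \<inter> D \<noteq> {}))"
      proof -
        have "{w \<in> K. new_clique (Suc n) K w \<inter> D \<noteq> {}} = {}"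
          using True ND unfolding new_clique_def by blast
        then have "card {w \<in> K. new_clique (Suc n) K w \<inter> D \<noteq> {}} = 0"
          by (simp only: card.empty)
        then show ?thesis
          by (subst snoc[of _ "\<lambda>K. K \<inter> D \<noteq> {}"]) (simp_all only: fst_conv True, simp_all)
      qed
      then show ?thesis
        unfolding D'' unfolding tr(1) using IH by simp
    next
      case False
      then have D'': "desc tr (NodeV j) = insert (NodeV (Suc n)) D" using D' by simp
      have "card (slots k (t @ [(K, p)]) (\<lambda>K. K \<inter> insert (NodeV (Suc n)) D \<noteq> {}))
          = card (slots k t (\<lambda>K. K \<inter> D \<noteq> {})) + 1 + k"
        by (subst snoc[of _ "\<lambda>K. K \<inter> D \<noteq> {}"])
           (use False ND NK clique_wf[OF k tr(2,3)] in \<open>auto simp: new_clique_def\<close>)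
      then show ?thesis
        unfolding D'' unfolding tr(1) using IH finD ND by (simp add: algebra_simps)
    qed
  qed
qed

section \<open>Counting trees by the number of descendants of a node\<close>

lemma ktrees_Suc_image:
  "ktrees k (Suc n) = (\<lambda>(tr, c). tr @ [c]) ` (SIGMA tr:ktrees k n. slots k tr (\<lambda>_. True))"
  by (auto simp: slots_def image_iff Bex_def)

lemma finite_ktrees: "1 \<le> k \<Longrightarrow> finite (ktrees k n)"
  by (induction n) (auto simp: ktrees_Suc_image finite_slots simp del: ktrees.simps(2))

lemma card_ktrees_Suc_filter:
  assumes "1 \<le> k"
  shows "card {tr \<in> ktrees k (Suc n). P tr}
    = (\<Sum>tr\<in>ktrees k n. card {c \<in> slots k tr (\<lambda>_. True). P (tr @ [c])})"
proof -
  have "{tr \<in> ktrees k (Suc n). P tr}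
      = (\<lambda>(tr, c). tr @ [c]) ` (SIGMA tr:ktrees k n. {c \<in> slots k tr (\<lambda>_. True). P (tr @ [c])})"
    unfolding ktrees_Suc_image by auto
  also have "card \<dots> = card (SIGMA tr:ktrees k n. {c \<in> slots k tr (\<lambda>_. True). P (tr @ [c])})"
    by (rule card_image) (auto simp: inj_on_def)
  also have "\<dots> = (\<Sum>tr\<in>ktrees k n. card {c \<in> slots k tr (\<lambda>_. True). P (tr @ [c])})"
    using finite_ktrees[OF assms] finite_slots[OF assms] by (intro card_SigmaI) auto
  finally show ?thesis .
qed

lemma card_ktrees_Suc:
  assumes "1 \<le> k"
  shows "card (ktrees k (Suc n)) = (1 + (k + 1) * n) * card (ktrees k n)"
  using card_ktrees_Suc_filter[OF assms, of n "\<lambda>_. True"] card_all_slots[OF assms]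
  by (simp del: ktrees.simps(2))

lemma card_ktrees_pos: "1 \<le> k \<Longrightarrow> 0 < card (ktrees k n)"
  by (induction n) (simp_all add: card_ktrees_Suc del: ktrees.simps(2))

definition desc_count :: "nat \<Rightarrow> nat \<Rightarrow> nat \<Rightarrow> nat \<Rightarrow> nat" where
  "desc_count k n j m = card {tr \<in> ktrees k n. card (desc tr (NodeV j)) = m}"

text \<open>The last insertion either misses the descendant set, which already has
  \<open>Suc m\<close> elements, or enlarges one of \<open>m\<close> elements. At
  \<open>m = 0\<close> the second coefficient is -1, but it multiplies a count that is zero by
  \<open>desc_count_0\<close>.\<close>

lemma desc_count_Suc:
  assumes k: "1 \<le> k" and j: "1 \<le> j" "j \<le> n"
  shows "real (desc_count k (Suc n) j (Suc m))
    = (1 + (real k + 1) * n - ((real k + 1) * Suc m - 1)) * desc_count k n j (Suc m)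
      + ((real k + 1) * m - 1) * desc_count k n j m"
proof -
  let ?D = "\<lambda>tr. card (desc tr (NodeV j))"
  have *: "real (card {c \<in> slots k tr (\<lambda>_. True). ?D (tr @ [c]) = Suc m})
    = (if ?D tr = Suc m then 1 + (real k + 1) * n - ((real k + 1) * Suc m - 1) else 0)
      + (if ?D tr = m then (real k + 1) * m - 1 else 0)" if tr: "tr \<in> ktrees k n" for tr
  proof -
    define D where "D = desc tr (NodeV j)"
    have "NodeV j \<in> verts k n" using j by simp
    note Dv = desc_subset_verts[OF tr this]
    have finD: "finite D" unfolding D_def using Dv finite_subset finite_verts by blast
    have ND: "NodeV (Suc n) \<notin> D" unfolding D_def using Dv by (auto dest!: subsetD)
    have cD: "?D (tr @ [c]) = (if fst c \<inter> D = {} then card D else Suc (card D))"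
      if "c \<in> slots k tr (\<lambda>_. True)" for c
    proof -
      have "fst c \<in> avail k tr"
        using that by (auto simp: slots_def)
      from desc_snoc[OF k tr this \<open>NodeV j \<in> verts k n\<close>, of "snd c"] show ?thesis
        using finD ND by (simp add: D_def[symmetric])
    qed
    let ?S1 = "slots k tr (\<lambda>K. K \<inter> D \<noteq> {})" and ?S0 = "slots k tr (\<lambda>K. K \<inter> D = {})"
    have "slots k tr (\<lambda>_. True) = ?S0 \<union> ?S1" "?S0 \<inter> ?S1 = {}"
      by (auto simp: slots_def)
    then have "card ?S0 + card ?S1 = 1 + (k + 1) * n"
      using card_all_slots[OF k tr] finite_slots[OF k tr] by (metis card_Un_disjoint)
    then have "real (card ?S0 + card ?S1) = real (1 + (k + 1) * n)"
      by (simp only:)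
    moreover have "real (card ?S1 + 1) = real ((k + 1) * card D)"
      using card_desc_slots[OF k tr j] by (simp only: D_def)
    \<comment> \<open>Passing to the reals makes the subtractions exact.\<close>
    ultimately have c1: "real (card ?S1) = (real k + 1) * card D - 1"
      and c0: "real (card ?S0) = 1 + (real k + 1) * n - ((real k + 1) * card D - 1)"
      by (simp_all add: algebra_simps)
    have "{c \<in> slots k tr (\<lambda>_. True). ?D (tr @ [c]) = Suc m} =
      {c \<in> slots k tr (\<lambda>_. True). (if fst c \<inter> D = {} then card D else Suc (card D)) = Suc m}"
      by (intro Collect_cong conj_cong refl) (simp only: cD)
    also have "\<dots> = (if card D = Suc m then ?S0 else if card D = m then ?S1 else {})"
      by (auto simp: slots_def)
    finally have S: "{c \<in> slots k tr (\<lambda>_. True). ?D (tr @ [c]) = Suc m}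
      = (if card D = Suc m then ?S0 else if card D = m then ?S1 else {})" .
    show ?thesis
      unfolding S D_def[symmetric] by (auto simp only: c0 c1 split: if_splits) auto
  qed
  have fin: "finite (ktrees k n)" using finite_ktrees[OF k] .
  have cnt: "(\<Sum>tr\<in>ktrees k n. if ?D tr = i then x else 0) = x * real (desc_count k n j i)" for i x
    unfolding desc_count_def using fin by (simp add: sum.If_cases Int_def)
  have "real (desc_count k (Suc n) j (Suc m))
      = (\<Sum>tr\<in>ktrees k n. real (card {c \<in> slots k tr (\<lambda>_. True). ?D (tr @ [c]) = Suc m}))"
    unfolding desc_count_def card_ktrees_Suc_filter[OF k] by simp
  also have "\<dots> = (\<Sum>tr\<in>ktrees k n.
      (if ?D tr = Suc m then 1 + (real k + 1) * n - ((real k + 1) * Suc m - 1) else 0)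
      + (if ?D tr = m then (real k + 1) * m - 1 else 0))"
    by (intro sum.cong refl *)
  finally show ?thesis
    by (simp only: sum.distrib cnt)
qed

text \<open>An empty descendant set would turn the slot identity \<open>card_desc_slots\<close> into
  a successor being equal to zero.\<close>

lemma desc_count_0:
  assumes "1 \<le> k" "1 \<le> j" "j \<le> n"
  shows "desc_count k n j 0 = 0"
proof -
  have "card (desc tr (NodeV j)) \<noteq> 0" if "tr \<in> ktrees k n" for tr
    using card_desc_slots[OF assms(1) that assms(2,3)] by (metis add_is_0 mult_0_right one_neq_zero)
  then have "{tr \<in> ktrees k n. card (desc tr (NodeV j)) = 0} = {}"
    by blast
  then show ?thesis
    by (simp only: desc_count_def card.empty)
qed

lemma desc_count_diag:
  assumes "1 \<le> k" "1 \<le> j"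
  shows "desc_count k j j m = (if m = 1 then card (ktrees k j) else 0)"
proof -
  have "card (desc tr (NodeV j)) = 1" if "tr \<in> ktrees k j" for tr
  proof -
    have "desc tr (NodeV j) = {NodeV j}"
    proof (rule desc_eq_singleton)
      fix x assume "x \<in> {1..length tr}"
      then show "NodeV j \<notin> par tr x"
        using par_wf[OF assms(1) that, of x] length_ktrees[OF that]
        by (auto dest!: subsetD)
    qed
    then show ?thesis by simp
  qed
  then have "{tr \<in> ktrees k j. card (desc tr (NodeV j)) = m} = (if m = 1 then ktrees k j else {})"
    by auto
  then show ?thesis
    by (simp add: desc_count_def)
qed

lemma pmf_Xlaw:
  assumes "1 \<le> k"
  shows "pmf (Xlaw k n j) m = desc_count k n j m / card (ktrees k n)"
proof -
  have "ktrees k n \<noteq> {}" using card_ktrees_pos[OF assms, of n] by auto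
  then show ?thesis
    using finite_ktrees[OF assms]
    by (simp add: Xlaw_def pmf_map measure_pmf_of_set desc_count_def vimage_def Int_def)
qed

section \<open>The urn and the exact law\<close>

text \<open>Probability of \<open>r\<close> successes in \<open>N\<close> draws from a Polya urn
  with initial weights \<open>a\<close> and \<open>b\<close>. The Pochhammer form makes the urn
  recurrence pure algebra, and the binomial coefficient makes the value zero for
  \<open>r > N\<close>.\<close>

definition beta_binomial :: "real \<Rightarrow> real \<Rightarrow> nat \<Rightarrow> nat \<Rightarrow> real" where
  "beta_binomial a b N r = real (N choose r) * pochhammer a r * pochhammer b (N - r) / pochhammer (a + b) N"

text \<open>One draw of the urn: after \<open>r\<close> successes among \<open>N\<close> draws the
  success weight is \<open>a + r\<close> and the failure weight is \<open>b + N - r\<close>, out of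
  a total of \<open>a + b + N\<close>.\<close>

lemma beta_binomial_Suc_Suc:
  assumes "0 < a" "0 < b"
  shows "beta_binomial a b (Suc N) (Suc r) * (a + b + N)
    = beta_binomial a b N (Suc r) * (b + N - Suc r) + beta_binomial a b N r * (a + r)"
proof -
  have P: "pochhammer (a + b) (Suc N) = pochhammer (a + b) N * (a + b + N)"
    by (simp add: pochhammer_rec')
  have nz: "pochhammer (a + b) N \<noteq> 0" "a + b + N \<noteq> 0"
    using assms pochhammer_pos[of "a + b" N] by auto
  have *: "beta_binomial a b (Suc N) (Suc r) * (a + b + N)
    = real (Suc N choose Suc r) * pochhammer a (Suc r) * pochhammer b (N - r) / pochhammer (a + b) N"
    unfolding beta_binomial_def P using nz by simp
  show ?thesis
  proof (cases "Suc r \<le> N")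
    case True
    then obtain d where N: "N = Suc r + d"
      using le_Suc_ex by blast
    have "pochhammer b (N - r) = pochhammer b d * (b + d)"
      by (simp add: N pochhammer_rec')
    moreover have "pochhammer a (Suc r) = pochhammer a r * (a + r)"
      by (simp add: pochhammer_rec')
    moreover have "N - Suc r = d"
      by (simp add: N)
    moreover have "b + real N - real (Suc r) = b + d"
      by (simp add: N)
    ultimately show ?thesis
      unfolding * unfolding beta_binomial_def using nz by (simp add: field_simps)
  next
    case False
    \<comment> \<open>At \<open>r = N\<close> only the path consisting of successes contributes;
      beyond that all three binomial coefficients vanish.\<close>
    show ?thesis
    proof (cases "r = N")
      case True
      have "pochhammer a (Suc r) = pochhammer a r * (a + r)"
        by (simp add: pochhammer_rec')
      then show ?thesis
        unfolding * unfolding beta_binomial_def using nz True by simp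
    next
      case False
      with \<open>\<not> Suc r \<le> N\<close> have "N choose r = 0" "N choose Suc r = 0" "Suc N choose Suc r = 0"
        by (simp_all add: binomial_eq_0)
      then show ?thesis
        unfolding * unfolding beta_binomial_def by (simp only: of_nat_0 mult_zero_left div_0 add_0)
    qed
  qed
qed

lemma beta_binomial_Suc_0:
  assumes "0 < a" "0 < b"
  shows "beta_binomial a b (Suc N) 0 * (a + b + N) = beta_binomial a b N 0 * (b + N)"
  using assms pochhammer_pos[of "a + b" N] by (simp add: beta_binomial_def pochhammer_rec')

text \<open>Measured in units of \<open>k + 1\<close> slots, \<open>(k + 1) * Suc r - 1\<close> is
  the success weight \<open>a + r\<close>, and the total \<open>1 + (k + 1) * (j + N)\<close> is
  \<open>a + b + N\<close>. Node \<open>j\<close> itself accounts for the shift from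
  \<open>r\<close> to \<open>Suc r\<close>.\<close>

lemma pmf_Xlaw_beta_binomial:
  fixes k j N r :: nat
  assumes k: "1 \<le> k" and j: "1 \<le> j"
  defines "a \<equiv> k / (real k + 1)" and "b \<equiv> real j - 1 + 2 / (real k + 1)"
  shows "pmf (Xlaw k (j + N) j) (Suc r) = beta_binomial a b N r"
proof (induction N arbitrary: r)
  case 0
  then show ?case
    using card_ktrees_pos[OF k, of j]
    by (cases r) (simp_all add: pmf_Xlaw[OF k] desc_count_diag[OF k j] beta_binomial_def)
next
  case (Suc N)
  have ab: "0 < a" "0 < b"
    using k j unfolding a_def b_def by (auto intro!: add_nonneg_pos divide_pos_pos)
  let ?n = "j + N" and ?q = "real k + 1"
  let ?T = "real (card (ktrees k ?n))" and ?tot = "1 + ?q * real ?n"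
  have T0: "?T \<noteq> 0" and tot: "?tot \<noteq> 0"
    using card_ktrees_pos[OF k, of ?n] by (simp_all add: add_nonneg_eq_0_iff)
  have q: "?q \<noteq> 0" by simp
  have qa: "?q * a = k" and qb: "?q * b = ?q * (real j - 1) + 2"
    unfolding a_def b_def distrib_left by (simp_all only: times_divide_eq_right nonzero_mult_div_cancel_left[OF q])
  have tot_eq: "?tot = ?q * (a + b + N)"
    unfolding distrib_left qa qb by (simp add: algebra_simps)
  have abN: "a + b + N \<noteq> 0" using ab by linarith
  have cnt: "desc_count k ?n j (Suc i) = beta_binomial a b N i * ?T" for i
    using Suc.IH[of i] T0 by (simp add: pmf_Xlaw[OF k] field_simps)
  have T': "real (card (ktrees k (Suc ?n))) = ?tot * ?T"
    unfolding card_ktrees_Suc[OF k] by (simp add: algebra_simps)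
  \<comment> \<open>The slots that leave the descendant set unchanged carry the failure weight of
    the urn.\<close>
  have black: "?tot - (?q * Suc i - 1) = ?q * (b + N - i)" for i
    unfolding tot_eq right_diff_distrib distrib_left qa qb by (simp add: algebra_simps)
  have "pmf (Xlaw k (Suc ?n) j) (Suc r) * (?tot * ?T) = desc_count k (Suc ?n) j (Suc r)"
    unfolding pmf_Xlaw[OF k] T' using T0 tot by simp
  also have "\<dots> = ?q * (b + N - r) * desc_count k ?n j (Suc r) + (?q * r - 1) * desc_count k ?n j r"
    unfolding desc_count_Suc[OF k j le_add1] black ..
  also have "\<dots> = beta_binomial a b (Suc N) r * (?tot * ?T)"
  \<comment> \<open>For \<open>r = 0\<close> the term with coefficient -1 drops out, since no tree
    has an empty descendant set; otherwise the urn recurrence applies.\<close>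
  proof (cases r)
    case 0
    have "beta_binomial a b (Suc N) 0 * (?q * (a + b + N) * ?T)
        = ?q * ?T * (beta_binomial a b (Suc N) 0 * (a + b + N))"
      by (simp only: mult_ac)
    also have "\<dots> = ?q * ?T * (beta_binomial a b N 0 * (b + N))"
      by (simp only: beta_binomial_Suc_0[OF ab])
    also have "\<dots> = ?q * (b + N) * (beta_binomial a b N 0 * ?T)"
      by (simp only: mult_ac)
    finally show ?thesis
      unfolding 0 desc_count_0[OF k j le_add1] cnt tot_eq
      by (simp only: of_nat_0 diff_zero mult_zero_right add_0_right)
  next
    case (Suc r')
    have w: "?q * real (Suc r') - 1 = ?q * (a + r')"
      unfolding distrib_left qa by (simp add: algebra_simps)
    have "?q * (b + N - r) * desc_count k ?n j (Suc r) + (?q * r - 1) * desc_count k ?n j r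
        = ?q * (b + N - Suc r') * (beta_binomial a b N (Suc r') * ?T) + ?q * (a + r') * (beta_binomial a b N r' * ?T)"
      by (simp only: Suc cnt w)
    also have "\<dots> = ?q * ?T * (beta_binomial a b N (Suc r') * (b + N - Suc r') + beta_binomial a b N r' * (a + r'))"
      by (simp only: algebra_simps)
    also have "\<dots> = ?q * ?T * (beta_binomial a b (Suc N) (Suc r') * (a + b + N))"
      by (simp only: beta_binomial_Suc_Suc[OF ab])
    also have "\<dots> = beta_binomial a b (Suc N) (Suc r') * (?tot * ?T)"
      unfolding tot_eq by (simp only: mult_ac)
    finally show ?thesis
      unfolding Suc .
  qed
  finally show ?case
    using T0 tot by simp
qed

lemma pmf_Xlaw_0:
  assumes "1 \<le> k" "1 \<le> j" "j \<le> n"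
  shows "pmf (Xlaw k n j) 0 = 0"
  by (simp add: pmf_Xlaw[OF assms(1)] desc_count_0[OF assms])

section \<open>The exact law in generalized binomial coefficients\<close>

lemma gchoose_eq_pochhammer: "(real s + x - 1) gchoose s = pochhammer x s / fact s"
  by (simp add: gbinomial_pochhammer')

text \<open>With \<open>m = Suc r\<close> and \<open>n = j + N\<close>, the three generalized
  binomials are the three rising factorials of the urn law divided by factorials, and these
  factorials combine to \<open>N choose r\<close>.\<close>

lemma pmf_Xlaw_gbinom:
  fixes k n j m :: nat
  assumes k: "1 \<le> k" and j: "1 \<le> j" "j \<le> n" and m: "1 \<le> m"
  shows "pmf (Xlaw k n j) m =
         gbinom (real m - 1 - 1 / (k + 1)) (int m - 1)
         * gbinom (real n - real m - 1 + 2 / (k + 1)) (int n - int m - int j + 1)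
         / gbinom (real n - k / (k + 1)) (int n - int j)"
proof -
  obtain r where r: "m = Suc r" using m by (cases m) auto
  obtain N where N: "n = j + N" using j le_Suc_ex by blast
  define a where "a = k / (real k + 1)"
  define b where "b = real j - 1 + 2 / (real k + 1)"
  have ka: "1 / (real k + 1) = 1 - a"
    unfolding a_def by (simp add: field_simps)
  have k2: "2 / (real k + 1) = b + 1 - real j"
    unfolding b_def by simp
  have ab: "a + b = real j + 1 - a"
    using ka by (simp add: b_def)
  have g1: "gbinom (real m - 1 - 1 / (k + 1)) (int m - 1) = pochhammer a r / fact r"
  proof -
    have "real m - 1 - 1 / (k + 1) = real r + a - 1"
      using ka by (simp add: r add.commute)
    moreover have "int m - 1 = int r"
      by (simp add: r)
    ultimately show ?thesis
      by (simp only: gbinom_def) (simp add: gchoose_eq_pochhammer)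
  qed
  have g3: "gbinom (real n - k / (k + 1)) (int n - int j) = pochhammer (a + b) N / fact N"
  proof -
    have "real n - k / (k + 1) = real N + (a + b) - 1"
      unfolding ab by (simp add: N a_def add.commute)
    moreover have "int n - int j = int N"
      by (simp add: N)
    ultimately show ?thesis
      by (simp only: gbinom_def) (simp add: gchoose_eq_pochhammer del: of_nat_add)
  qed
  show ?thesis
  proof (cases "r \<le> N")
    case True
    have "real n - real m - 1 + 2 / (k + 1) = real (N - r) + b - 1"
      using True k2 by (simp add: N r of_nat_diff add.commute)
    moreover have "int n - int m - int j + 1 = int (N - r)"
      using True by (simp add: N r)
    ultimately have g2: "gbinom (real n - real m - 1 + 2 / (k + 1)) (int n - int m - int j + 1)
        = pochhammer b (N - r) / fact (N - r)"
      by (simp only: gbinom_def) (simp add: gchoose_eq_pochhammer del: of_nat_diff)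
    have "pmf (Xlaw k n j) m = beta_binomial a b N r"
      unfolding N r a_def b_def by (rule pmf_Xlaw_beta_binomial[OF k j(1)])
    also have "\<dots> = fact N / (fact r * fact (N - r)) * pochhammer a r * pochhammer b (N - r) / pochhammer (a + b) N"
      by (simp only: beta_binomial_def binomial_fact[OF True])
    also have "\<dots> = pochhammer a r / fact r * (pochhammer b (N - r) / fact (N - r)) / (pochhammer (a + b) N / fact N)"
      by simp
    finally show ?thesis
      unfolding g1 g2 g3 .
  next
    case False
    \<comment> \<open>More descendants than later nodes allow: the lower index is negative, where
      \<open>gbinom\<close> is 0 by definition, and the urn law vanishes as well.\<close>
    then have "gbinom (real n - real m - 1 + 2 / (k + 1)) (int n - int m - int j + 1) = 0"
      by (simp add: gbinom_def N r)
    moreover have "pmf (Xlaw k n j) m = 0"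
      using pmf_Xlaw_beta_binomial[OF k j(1), of N r] False by (simp add: N r beta_binomial_def)
    ultimately show ?thesis by simp
  qed
qed

section \<open>Beta and Gamma laws\<close>

lemma beta_density_nonneg: "0 < a \<Longrightarrow> 0 < b \<Longrightarrow> 0 \<le> beta_density a b x"
  by (simp add: beta_density_def Beta_def)

lemma gamma_density_nonneg: "0 < a \<Longrightarrow> 0 \<le> gamma_density a \<theta> x"
  by (simp add: gamma_density_def)

lemma measurable_beta_density [measurable]: "beta_density a b \<in> borel_measurable borel"
  unfolding beta_density_def by measurable

lemma measurable_gamma_density [measurable]: "gamma_density a \<theta> \<in> borel_measurable borel"
  unfolding gamma_density_def by measurable

lemma Beta_real_pos: "0 < a \<Longrightarrow> 0 < b \<Longrightarrow> 0 < Beta a (b::real)"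
  by (simp add: Beta_def)

text \<open>Carries the gauge integrals that define the Beta and Gamma functions over to Lebesgue
  integrals; nonnegativity supplies the integrability.\<close>

lemma has_bochner_integral_lborel_nonneg:
  fixes f :: "real \<Rightarrow> real"
  assumes "f \<in> borel_measurable borel" "A \<in> sets borel" "\<And>x. x \<in> A \<Longrightarrow> 0 \<le> f x" "(f has_integral I) A" "0 \<le> I"
  shows "has_bochner_integral lborel (\<lambda>x. indicator A x * f x) I"
proof (rule has_bochner_integral_nn_integral)
  show "(\<lambda>x. indicator A x * f x) \<in> borel_measurable lborel"
    using assms(1,2) by simp
  show "AE x in lborel. 0 \<le> indicator A x * f x"
    using assms(3) by (auto simp: indicator_def)
  show "(\<integral>\<^sup>+ x. ennreal (indicator A x * f x) \<partial>lborel) = ennreal I"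
    using nn_integral_has_integral_lebesgue[OF assms(3,4)] by simp
qed fact

text \<open>The gauge integral lives on the closed interval while \<open>beta_density\<close> is
  supported on the open one; the endpoints form a null set.\<close>

lemma has_bochner_integral_Beta_integrand:
  assumes "0 < a" "0 < (b::real)"
  shows "has_bochner_integral lborel
    (\<lambda>x. indicator {0<..<1} x * (x powr (a - 1) * (1 - x) powr (b - 1))) (Beta a b)"
proof -
  have "has_bochner_integral lborel
      (\<lambda>x. indicator {0..1} x * (x powr (a - 1) * (1 - x) powr (b - 1))) (Beta a b)"
    using Beta_real_pos[OF assms]
    by (intro has_bochner_integral_lborel_nonneg has_integral_Beta_real assms) auto
  then show ?thesis
    by (rule has_bochner_integral_discrete_difference[where X="{0,1}", THEN iffD1, rotated 4])
       (auto simp: indicator_def)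
qed

lemma has_bochner_integral_Gamma_integrand:
  assumes "0 < (a::real)"
  shows "has_bochner_integral lborel (\<lambda>x. indicator {0<..} x * (x powr (a - 1) * exp (- x))) (Gamma a)"
proof -
  have "has_bochner_integral lborel (\<lambda>x. indicator {0..} x * (x powr (a - 1) / exp x)) (Gamma a)"
    using Gamma_real_pos[OF assms]
    by (intro has_bochner_integral_lborel_nonneg Gamma_integral_real assms) auto
  then show ?thesis
    by (rule has_bochner_integral_discrete_difference[where X="{0}", THEN iffD1, rotated 4])
       (auto simp: indicator_def exp_minus divide_inverse)
qed

lemma Beta_ratio:
  assumes "0 < a" "0 < (b::real)"
  shows "Beta (a + real r) (b + real s) / Beta a b = pochhammer a r * pochhammer b s / pochhammer (a + b) (r + s)"
proof -
  have "pochhammer x n = Gamma (x + real n) / Gamma x" if "0 < x" for x n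
    using that by (intro pochhammer_Gamma) (auto elim!: nonpos_Ints_cases')
  then show ?thesis
    using assms Gamma_real_pos[of a] Gamma_real_pos[of b] Gamma_real_pos[of "a + b"]
    by (simp add: Beta_def field_simps)
qed

text \<open>Multiplying the density by the monomial shifts the parameters to \<open>a + r\<close>
  and \<open>b + s\<close>, which leaves a ratio of Beta functions. Total mass, mean, moments and
  Bernstein integrals are all instances.\<close>

lemma has_bochner_integral_Beta_distr_monom:
  assumes ab: "0 < a" "0 < b"
  shows "has_bochner_integral (Beta_distr a b) (\<lambda>x. x ^ r * (1 - x) ^ s)
    (pochhammer a r * pochhammer b s / pochhammer (a + b) (r + s))"
  unfolding Beta_distr_def
proof (rule has_bochner_integral_density)
  have "has_bochner_integral lborel (\<lambda>x. indicator {0<..<1} x *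
      (x powr (a + real r - 1) * (1 - x) powr (b + real s - 1)) / Beta a b)
      (Beta (a + real r) (b + real s) / Beta a b)"
    using ab by (intro has_bochner_integral_divide_zero has_bochner_integral_Beta_integrand) auto
  also have "(\<lambda>x. indicator {0<..<1} x *
      (x powr (a + real r - 1) * (1 - x) powr (b + real s - 1)) / Beta a b)
      = (\<lambda>x. beta_density a b x *\<^sub>R (x ^ r * (1 - x) ^ s))"
  proof
    fix x :: real
    have "y powr (c + real n - 1) = y powr (c - 1) * y ^ n" if "0 < y" for y c :: real and n
      using that by (simp add: powr_realpow[symmetric] powr_add[symmetric] algebra_simps)
    from this[of x a r] this[of "1 - x" b s]
    show "indicator {0<..<1} x * (x powr (a + real r - 1) * (1 - x) powr (b + real s - 1)) / Beta a b
        = beta_density a b x *\<^sub>R (x ^ r * (1 - x) ^ s)"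
      by (simp add: beta_density_def indicator_def)
  qed
  finally show "has_bochner_integral lborel (\<lambda>x. beta_density a b x *\<^sub>R (x ^ r * (1 - x) ^ s))
    (pochhammer a r * pochhammer b s / pochhammer (a + b) (r + s))"
    by (simp only: Beta_ratio[OF ab])
qed (use beta_density_nonneg[OF ab] in auto)

lemma has_bochner_integral_Gamma_distr_power:
  assumes a: "0 < a"
  shows "has_bochner_integral (Gamma_distr a 1) (\<lambda>x. x ^ s) (pochhammer a s)"
  unfolding Gamma_distr_def
proof (rule has_bochner_integral_density)
  have "has_bochner_integral lborel (\<lambda>x. indicator {0<..} x * (x powr (a + real s - 1) * exp (- x)) / Gamma a)
      (Gamma (a + real s) / Gamma a)"
    using a by (intro has_bochner_integral_divide_zero has_bochner_integral_Gamma_integrand) auto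
  also have "(\<lambda>x. indicator {0<..} x * (x powr (a + real s - 1) * exp (- x)) / Gamma a)
      = (\<lambda>x. gamma_density a 1 x *\<^sub>R x ^ s)"
  proof
    fix x :: real
    have "x powr (a + real s - 1) = x powr (a - 1) * x ^ s" if "0 < x"
      using that by (simp add: powr_realpow[symmetric] powr_add[symmetric] algebra_simps)
    then show "indicator {0<..} x * (x powr (a + real s - 1) * exp (- x)) / Gamma a
        = gamma_density a 1 x *\<^sub>R x ^ s"
      by (simp add: gamma_density_def indicator_def)
  qed
  also have "Gamma (a + real s) / Gamma a = pochhammer a s"
    using a by (intro pochhammer_Gamma[symmetric]) (auto elim!: nonpos_Ints_cases')
  finally show "has_bochner_integral lborel (\<lambda>x. gamma_density a 1 x *\<^sub>R x ^ s) (pochhammer a s)" .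
qed (use gamma_density_nonneg[OF a] in auto)

lemma real_distribution_density:
  assumes "has_bochner_integral (density lborel f) (\<lambda>x. 1::real) 1"
  shows "real_distribution (density lborel f)"
proof -
  have "(\<integral>\<^sup>+x. ennreal 1 \<partial>density lborel f) = ennreal 1"
    using assms by (subst nn_integral_eq_integral) (auto simp: has_bochner_integral_iff)
  then have "prob_space (density lborel f)"
    by (intro prob_spaceI) simp
  then show ?thesis
    by (simp add: real_distribution_def real_distribution_axioms_def)
qed

lemma real_distribution_Beta:
  assumes "0 < a" "0 < b"
  shows "real_distribution (Beta_distr a b)"
  using has_bochner_integral_Beta_distr_monom[OF assms, of 0 0]
  unfolding Beta_distr_def by (intro real_distribution_density) simp

lemma real_distribution_Gamma:
  assumes "0 < a"
  shows "real_distribution (Gamma_distr a 1)"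
  using has_bochner_integral_Gamma_distr_power[OF assms, of 0]
  unfolding Gamma_distr_def by (intro real_distribution_density) simp

lemma AE_Beta_distr:
  assumes "0 < a" "0 < b"
  shows "AE x in Beta_distr a b. 0 < x \<and> x < 1"
  unfolding Beta_distr_def by (subst AE_density) (auto simp: beta_density_def)

text \<open>This is the mixture representation: averaging binomial weights over a Beta distributed
  success probability gives the beta-binomial weights.\<close>

lemma has_bochner_integral_Bernstein:
  assumes "0 < a" "0 < b" "r \<le> N"
  shows "has_bochner_integral (Beta_distr a b) (Bernstein N r) (beta_binomial a b N r)"
  unfolding Bernstein_def
  using has_bochner_integral_mult_right[OF has_bochner_integral_Beta_distr_monom[OF assms(1,2), of r "N - r"],
      of "real (N choose r)"] assms(3)
  by (simp add: beta_binomial_def mult_ac)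

section \<open>Concentration of beta-binomial laws around Beta laws\<close>

text \<open>Variance plus squared bias of a scaled binomial variable. The bias comes from the
  summand 1, which accounts for node \<open>j\<close> being its own descendant.\<close>

lemma sum_Bernstein_deviation:
  assumes "0 \<le> x"
  shows "(\<Sum>r\<le>N. (c * (1 + real r) - c * real N * x)\<^sup>2 * Bernstein N r x) \<le> c\<^sup>2 + c\<^sup>2 * real N * x"
proof -
  define y where "y = real N * x"
  \<comment> \<open>The square is expanded in \<open>r * (r - 1)\<close>, \<open>r\<close> and 1,
    whose Bernstein sums are known.\<close>
  have "(c * (1 + real r) - c * real N * x)\<^sup>2 * Bernstein N r x
      = c\<^sup>2 * (real r * (real r - 1) * Bernstein N r x)
        + c\<^sup>2 * (3 - 2 * y) * (real r * Bernstein N r x) + c\<^sup>2 * (1 - y)\<^sup>2 * Bernstein N r x" for r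
    unfolding y_def by (simp add: power2_eq_square algebra_simps)
  then have "(\<Sum>r\<le>N. (c * (1 + real r) - c * real N * x)\<^sup>2 * Bernstein N r x)
      = c\<^sup>2 * (real N * (real N - 1) * x\<^sup>2) + c\<^sup>2 * (3 - 2 * y) * (real N * x) + c\<^sup>2 * (1 - y)\<^sup>2"
    by (simp add: sum.distrib flip: sum_distrib_left)
  also have "\<dots> = c\<^sup>2 + c\<^sup>2 * real N * x - c\<^sup>2 * (real N * x\<^sup>2)"
    unfolding y_def by (simp add: power2_eq_square algebra_simps)
  also have "\<dots> \<le> c\<^sup>2 + c\<^sup>2 * real N * x"
    by simp
  finally show ?thesis .
qed

lemma sum_Bernstein_Lipschitz:
  fixes f :: "real \<Rightarrow> real"
  assumes x: "0 \<le> x" "x \<le> 1" and \<delta>: "0 < \<delta>" and L: "0 \<le> L" "\<And>x y. \<bar>f x - f y\<bar> \<le> L * \<bar>x - y\<bar>"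
  shows "\<bar>(\<Sum>r\<le>N. f (c * (1 + real r)) * Bernstein N r x) - f (c * real N * x)\<bar>
    \<le> L * (\<delta> + (c\<^sup>2 + c\<^sup>2 * real N * x) / \<delta>)"
proof -
  let ?y = "c * real N * x" and ?u = "\<lambda>r. c * (1 + real r) - c * real N * x"
  have "(\<Sum>r\<le>N. f (c * (1 + real r)) * Bernstein N r x) - f ?y
      = (\<Sum>r\<le>N. (f (c * (1 + real r)) - f ?y) * Bernstein N r x)"
    by (simp add: left_diff_distrib sum_subtractf flip: sum_distrib_left)
  also have "\<bar>\<dots>\<bar> \<le> (\<Sum>r\<le>N. L * (\<delta> + (?u r)\<^sup>2 / \<delta>) * Bernstein N r x)"
  proof (rule order_trans[OF sum_abs], rule sum_mono)
    fix r
    have B: "0 \<le> Bernstein N r x"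
      using x by (rule Bernstein_nonneg)
    \<comment> \<open>A deviation is at most \<delta>, or else at most its square divided by
      \<delta>. This trades the first absolute moment for the computable second one.\<close>
    have "\<bar>?u r\<bar> \<le> \<delta> + (?u r)\<^sup>2 / \<delta>"
    proof (cases "\<bar>?u r\<bar> \<le> \<delta>")
      case True
      then show ?thesis using \<delta> by (simp add: add_increasing2)
    next
      case False
      then have "\<bar>?u r\<bar> * \<delta> \<le> \<bar>?u r\<bar> * \<bar>?u r\<bar>"
        by (intro mult_left_mono) auto
      then have "\<bar>?u r\<bar> \<le> (?u r)\<^sup>2 / \<delta>"
        using \<delta> by (simp add: pos_le_divide_eq power2_eq_square)
      then show ?thesis using \<delta> by linarith
    qed
    then have "\<bar>f (c * (1 + real r)) - f ?y\<bar> \<le> L * (\<delta> + (?u r)\<^sup>2 / \<delta>)"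
      using L(1) by (intro order_trans[OF L(2)] mult_left_mono)
    then show "\<bar>(f (c * (1 + real r)) - f ?y) * Bernstein N r x\<bar> \<le> L * (\<delta> + (?u r)\<^sup>2 / \<delta>) * Bernstein N r x"
      using B by (simp add: abs_mult mult_right_mono)
  qed
  also have "\<dots> = L * (\<delta> + (\<Sum>r\<le>N. (?u r)\<^sup>2 * Bernstein N r x) / \<delta>)"
  proof -
    have "L * (\<delta> + (?u r)\<^sup>2 / \<delta>) * Bernstein N r x
        = L * \<delta> * Bernstein N r x + L / \<delta> * ((?u r)\<^sup>2 * Bernstein N r x)" for r
      by (simp add: distrib_left distrib_right)
    then have "(\<Sum>r\<le>N. L * (\<delta> + (?u r)\<^sup>2 / \<delta>) * Bernstein N r x)
        = (\<Sum>r\<le>N. L * \<delta> * Bernstein N r x) + (\<Sum>r\<le>N. L / \<delta> * ((?u r)\<^sup>2 * Bernstein N r x))"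
      by (simp only: sum.distrib)
    then show ?thesis
      by (simp only: sum_distrib_left[symmetric] sum_Bernstein) (simp add: distrib_left)
  qed
  also have "\<dots> \<le> L * (\<delta> + (c\<^sup>2 + c\<^sup>2 * real N * x) / \<delta>)"
    using sum_Bernstein_deviation[OF x(1), where N=N and c=c] \<delta> L(1)
    by (intro mult_left_mono add_left_mono divide_right_mono) auto
  finally show ?thesis .
qed

text \<open>The pointwise Bernstein estimate is integrated against the Beta law; in the error term
  \<open>x\<close> becomes the mean \<open>a / (a + b)\<close>.\<close>

lemma beta_binomial_Lipschitz_approx:
  fixes f :: "real \<Rightarrow> real"
  assumes ab: "0 < a" "0 < b" and \<delta>: "0 < \<delta>"
    and L: "0 \<le> L" "\<And>x y. \<bar>f x - f y\<bar> \<le> L * \<bar>x - y\<bar>"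
    and f [measurable]: "f \<in> borel_measurable borel" and bdd: "\<And>x. \<bar>f x\<bar> \<le> 1"
  shows "\<bar>(\<Sum>r\<le>N. f (c * (1 + real r)) * beta_binomial a b N r) - (\<integral>x. f (c * real N * x) \<partial>Beta_distr a b)\<bar>
    \<le> L * (\<delta> + (c\<^sup>2 + c\<^sup>2 * real N * (a / (a + b))) / \<delta>)"
proof -
  interpret real_distribution "Beta_distr a b"
    by (rule real_distribution_Beta[OF ab])
  let ?M = "Beta_distr a b"
  let ?S = "\<lambda>x. \<Sum>r\<le>N. f (c * (1 + real r)) * Bernstein N r x"
  let ?g = "\<lambda>x. L * (\<delta> + (c\<^sup>2 + c\<^sup>2 * real N * x) / \<delta>)"
  have S: "has_bochner_integral ?M ?S (\<Sum>r\<le>N. f (c * (1 + real r)) * beta_binomial a b N r)"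
    by (intro has_bochner_integral_sum has_bochner_integral_mult_right has_bochner_integral_Bernstein ab) simp
  have If: "integrable ?M (\<lambda>x. f (c * real N * x))"
    using bdd by (intro integrable_const_bound[where B = 1]) auto
  have "has_bochner_integral ?M (\<lambda>x. x) (a / (a + b))"
    using has_bochner_integral_Beta_distr_monom[OF ab, of 1 0] by simp
  then have Ix: "integrable ?M (\<lambda>x. x)" "(\<integral>x. x \<partial>?M) = a / (a + b)"
    by (auto simp: has_bochner_integral_iff)
  have "(\<Sum>r\<le>N. f (c * (1 + real r)) * beta_binomial a b N r) - (\<integral>x. f (c * real N * x) \<partial>?M)
      = (\<integral>x. ?S x - f (c * real N * x) \<partial>?M)"
    using S If by (subst Bochner_Integration.integral_diff) (auto simp: has_bochner_integral_iff)
  also have "\<bar>\<dots>\<bar> \<le> (\<integral>x. ?g x \<partial>?M)"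
  proof (rule order_trans[OF integral_abs_bound], rule integral_mono_AE)
    show "integrable ?M (\<lambda>x. \<bar>?S x - f (c * real N * x)\<bar>)"
      using S If by (auto simp: has_bochner_integral_iff)
    show "integrable ?M ?g"
      using Ix by auto
    show "AE x in ?M. \<bar>?S x - f (c * real N * x)\<bar> \<le> ?g x"
      using AE_Beta_distr[OF ab] by eventually_elim (use sum_Bernstein_Lipschitz[OF _ _ \<delta> L] in auto)
  qed
  also have "\<dots> = L * (\<delta> + (c\<^sup>2 + c\<^sup>2 * real N * (a / (a + b))) / \<delta>)"
    using Ix prob_space by simp
  finally show ?thesis .
qed

text \<open>Once the second moment of the deviation tends to 0, the remaining error is a multiple of
  the free parameter \<delta>, so the sum inherits the limit of the Beta integral.\<close>

lemma beta_binomial_Lipschitz_tendsto: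
  fixes f :: "real \<Rightarrow> real" and b c :: "nat \<Rightarrow> real" and N :: "nat \<Rightarrow> nat"
  assumes a: "0 < a" and b: "\<forall>\<^sub>F n in sequentially. 0 < b n"
    and L: "0 \<le> L" "\<And>x y. \<bar>f x - f y\<bar> \<le> L * \<bar>x - y\<bar>"
    and f: "f \<in> borel_measurable borel" "\<And>x. \<bar>f x\<bar> \<le> 1"
    and c: "c \<longlonglongrightarrow> 0" "(\<lambda>n. (c n)\<^sup>2 * real (N n) * (a / (a + b n))) \<longlonglongrightarrow> 0"
    and lim: "(\<lambda>n. \<integral>x. f (c n * real (N n) * x) \<partial>Beta_distr a (b n)) \<longlonglongrightarrow> l"
  shows "(\<lambda>n. \<Sum>r\<le>N n. f (c n * (1 + real r)) * beta_binomial a (b n) (N n) r) \<longlonglongrightarrow> l"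
proof -
  let ?S = "\<lambda>n. \<Sum>r\<le>N n. f (c n * (1 + real r)) * beta_binomial a (b n) (N n) r"
  let ?I = "\<lambda>n. \<integral>x. f (c n * real (N n) * x) \<partial>Beta_distr a (b n)"
  let ?e = "\<lambda>n. (c n)\<^sup>2 + (c n)\<^sup>2 * real (N n) * (a / (a + b n))"
  have e: "?e \<longlonglongrightarrow> 0"
    using tendsto_add[OF tendsto_power[OF c(1), of 2] c(2)] by simp
  have "(\<lambda>n. ?S n - ?I n) \<longlonglongrightarrow> 0"
  proof (rule LIMSEQ_I)
    fix \<epsilon> :: real assume "0 < \<epsilon>"
    \<comment> \<open>This choice makes \<open>2 * L * \<delta>\<close> smaller than \<epsilon>;
      dividing by \<open>L + 1\<close> also covers \<open>L = 0\<close>.\<close>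
    define \<delta> where "\<delta> = \<epsilon> / 2 / (L + 1)"
    have \<delta>: "0 < \<delta>" using \<open>0 < \<epsilon>\<close> L(1) by (simp add: \<delta>_def)
    have "\<forall>\<^sub>F n in sequentially. ?e n < \<delta>\<^sup>2"
      using \<delta> by (intro order_tendstoD(2)[OF e]) simp
    with b have "\<forall>\<^sub>F n in sequentially. norm (?S n - ?I n - 0) < \<epsilon>"
    proof eventually_elim
      case (elim n)
      have "\<bar>?S n - ?I n\<bar> \<le> L * (\<delta> + ?e n / \<delta>)"
        by (rule beta_binomial_Lipschitz_approx[OF a elim(1) \<delta> L f])
      also have "?e n / \<delta> \<le> \<delta>\<^sup>2 / \<delta>"
        using elim(2) \<delta> by (intro divide_right_mono) auto
      then have "L * (\<delta> + ?e n / \<delta>) \<le> L * (\<delta> + \<delta>)"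
        using L(1) \<delta> by (intro mult_left_mono) (auto simp: power2_eq_square)
      also have "L * (\<delta> + \<delta>) < (L + 1) * (\<delta> + \<delta>)"
        using \<delta> by (intro mult_strict_right_mono) auto
      also have "\<delta> + \<delta> = \<epsilon> / (L + 1)"
        unfolding \<delta>_def add_divide_distrib[symmetric] by (simp only: mult_2[symmetric] nonzero_mult_div_cancel_left zero_neq_numeral[symmetric] not_False_eq_True)
      also have "(L + 1) * (\<epsilon> / (L + 1)) = \<epsilon>"
        using L(1) by simp
      finally show ?case by simp
    qed
    then show "\<exists>no. \<forall>n\<ge>no. norm (?S n - ?I n - 0) < \<epsilon>"
      by (simp add: eventually_sequentially)
  qed
  from tendsto_add[OF this lim] show ?thesis by simp
qed

text \<open>The step function is an affine function of slope \<open>- 1 / (v - u)\<close> clamped to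
  the unit interval, and clamping does not increase distances.\<close>

lemma cts_step_Lipschitz:
  assumes "u < v"
  shows "\<bar>cts_step u v x - cts_step u v y\<bar> \<le> 1 / (v - u) * \<bar>x - y\<bar>"
proof -
  have eq: "cts_step u v z = max 0 (min 1 ((v - z) / (v - u)))" for z
    using assms by (auto simp: cts_step_def max_def min_def divide_simps)
  have "\<bar>max 0 (min 1 s) - max 0 (min 1 t)\<bar> \<le> \<bar>s - t\<bar>" for s t :: real
    by (auto simp: max_def min_def)
  then have "\<bar>cts_step u v x - cts_step u v y\<bar> \<le> \<bar>(v - x) / (v - u) - (v - y) / (v - u)\<bar>"
    unfolding eq .
  also have "(v - x) / (v - u) - (v - y) / (v - u) = (y - x) / (v - u)"
    by (simp add: diff_divide_distrib[symmetric])
  also have "\<bar>\<dots>\<bar> = 1 / (v - u) * \<bar>x - y\<bar>"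
    using assms by (simp add: abs_minus_commute)
  finally show ?thesis .
qed

lemma cts_step_bounds: "u < v \<Longrightarrow> \<bar>cts_step u v x\<bar> \<le> 1"
  by (auto simp: cts_step_def divide_simps)

lemma isCont_cts_step: "u < v \<Longrightarrow> isCont (cts_step u v) x"
  using uniformly_continuous_imp_continuous[OF cts_step_uniformly_continuous]
  by (simp add: continuous_on_eq_continuous_at)

text \<open>A \<open>pmf\<close> measures all sets, whereas the convergence criterion asks for
  measures on the Borel sets. Pushing forward along the identity changes the sigma-algebra but not
  the \<open>cdf\<close>.\<close>

lemma weak_conv_m_pmfI:
  fixes p :: "nat \<Rightarrow> real pmf"
  assumes M: "real_distribution M"
    and lim: "\<And>u v. u < v \<Longrightarrow> (\<lambda>n. measure_pmf.expectation (p n) (cts_step u v)) \<longlonglongrightarrow> integral\<^sup>L M (cts_step u v)"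
  shows "weak_conv_m (\<lambda>n. measure_pmf (p n)) M"
proof -
  let ?D = "\<lambda>n. distr (measure_pmf (p n)) borel (\<lambda>x. x)"
  have "real_distribution (?D n)" for n
    by (intro prob_space.real_distribution_distr) (simp_all add: prob_space_measure_pmf)
  moreover have "(\<lambda>n. integral\<^sup>L (?D n) (cts_step u v)) \<longlonglongrightarrow> integral\<^sup>L M (cts_step u v)" if "u < v" for u v
    using lim[OF that] by (subst integral_distr) (auto simp: cts_step_def[abs_def])
  ultimately have "weak_conv_m ?D M"
    by (intro integral_cts_step_conv_imp_weak_conv M)
  moreover have "cdf (?D n) = cdf (measure_pmf (p n))" for n
    by (auto simp: cdf_def2 measure_distr)
  ultimately show ?thesis
    by (simp add: weak_conv_m_def)
qed

text \<open>Besides node \<open>j\<close> itself, at most the \<open>n - j\<close> later nodes can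
  be descendants, so the expectation is a finite sum over the urn law.\<close>

lemma Xlaw_expectation:
  assumes k: "1 \<le> k" and j: "1 \<le> j" "j \<le> n"
  shows "measure_pmf.expectation (Xlaw k n j) g =
    (\<Sum>r\<le>n - j. g (Suc r) * beta_binomial (k / (real k + 1)) (real j - 1 + 2 / (real k + 1)) (n - j) r)"
proof -
  have pmf: "pmf (Xlaw k n j) (Suc r) = beta_binomial (k / (real k + 1)) (real j - 1 + 2 / (real k + 1)) (n - j) r" for r
    using pmf_Xlaw_beta_binomial[OF k j(1), of "n - j" r] j(2) by simp
  have "measure_pmf.expectation (Xlaw k n j) g = (\<Sum>m\<in>Suc ` {..n - j}. g m * pmf (Xlaw k n j) m)"
  proof (rule integral_measure_pmf_real)
    fix m assume m: "m \<in> set_pmf (Xlaw k n j)"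
    then obtain r where r: "m = Suc r"
      using pmf_Xlaw_0[OF k j] by (cases m) (auto simp: set_pmf_iff)
    then have "beta_binomial (k / (real k + 1)) (real j - 1 + 2 / (real k + 1)) (n - j) r \<noteq> 0"
      using m by (simp add: set_pmf_iff pmf)
    then have "r \<le> n - j"
      unfolding beta_binomial_def by (metis binomial_eq_0 div_0 mult_zero_left not_le of_nat_0)
    then show "m \<in> Suc ` {..n - j}" by (simp add: r)
  qed simp
  also have "\<dots> = (\<Sum>r\<le>n - j. g (Suc r) * pmf (Xlaw k n j) (Suc r))"
    by (subst sum.reindex) (auto simp: inj_on_def)
  finally show ?thesis
    by (simp only: pmf)
qed

section \<open>From Beta to Gamma\<close>

text \<open>The dominating function for the passage from Beta to Gamma, obtained from the Gamma
  integrand by halving the argument.\<close>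

lemma integrable_powr_exp_half:
  assumes "0 < (a::real)"
  shows "integrable lborel (\<lambda>x. indicator {0<..} x * (x powr (a - 1) * exp (- x / 2)))"
proof -
  have "integrable lborel (\<lambda>x. indicator {0<..} x * (x powr (a - 1) * exp (- x)))"
    using has_bochner_integral_Gamma_integrand[OF assms] by (simp add: has_bochner_integral_iff)
  then have "integrable lborel (\<lambda>x. 2 powr (a - 1) *
      (indicator {0<..} (0 + 1/2 * x) * ((0 + 1/2 * x) powr (a - 1) * exp (- (0 + 1/2 * x)))))"
    by (intro integrable_mult_right lborel_integrable_real_affine) auto
  also have "(\<lambda>x. 2 powr (a - 1) *
      (indicator {0<..} (0 + 1/2 * x) * ((0 + 1/2 * x) powr (a - 1) * exp (- (0 + 1/2 * x)))))
    = (\<lambda>x. indicator {0<..} x * (x powr (a - 1) * exp (- x / 2)))"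
  proof
    fix x :: real
    have "2 powr (a - 1) * (1/2 * x) powr (a - 1) = x powr (a - 1)" if "0 < x"
      using that by (subst powr_mult[symmetric]) auto
    then show "2 powr (a - 1) * (indicator {0<..} (0 + 1/2 * x) * ((0 + 1/2 * x) powr (a - 1) * exp (- (0 + 1/2 * x))))
      = indicator {0<..} x * (x powr (a - 1) * exp (- x / 2))"
      by (auto simp: indicator_def mult.assoc[symmetric])
  qed
  finally show ?thesis .
qed

text \<open>Dominated convergence: once \<open>(\<beta> - 1) / \<sigma>\<close> exceeds 1/2, the
  inequality \<open>1 - t <= exp (- t)\<close> bounds the second factor by
  \<open>exp (- x / 2)\<close>. Scale and parameter are kept apart because the application scales by
  \<open>j * (n - j) / n\<close>.\<close>

lemma scaled_beta_integral_tendsto: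
  fixes \<beta> \<sigma> :: "nat \<Rightarrow> real" and g :: "real \<Rightarrow> real"
  assumes a: "0 < a" and lam: "filterlim \<sigma> at_top sequentially"
    and ratio: "(\<lambda>n. (\<beta> n - 1) / \<sigma> n) \<longlonglongrightarrow> 1"
    and g [measurable]: "g \<in> borel_measurable borel" and bdd: "\<And>x. \<bar>g x\<bar> \<le> 1"
  shows "(\<lambda>n. \<integral>x. g x * (indicator {0<..<\<sigma> n} x * (x powr (a - 1) * (1 - x / \<sigma> n) powr (\<beta> n - 1))) \<partial>lborel)
    \<longlonglongrightarrow> (\<integral>x. g x * (indicator {0<..} x * (x powr (a - 1) * exp (- x))) \<partial>lborel)"
    (is "(\<lambda>n. integral\<^sup>L lborel (?F n)) \<longlonglongrightarrow> integral\<^sup>L lborel ?G")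
proof -
  let ?w = "\<lambda>x::real. indicator {0<..} x * (x powr (a - 1) * exp (- x / 2))"
  have "\<forall>\<^sub>F n in sequentially. (\<beta> n - 1) / \<sigma> n > 1/2"
    by (rule order_tendstoD(1)[OF ratio]) simp
  moreover have lam0: "\<forall>\<^sub>F n in sequentially. \<sigma> n > 0"
    using lam by (simp add: filterlim_at_top_dense)
  ultimately have "\<forall>\<^sub>F n in sequentially. \<sigma> n > 0 \<and> (\<beta> n - 1) / \<sigma> n > 1/2"
    by eventually_elim auto
  then obtain n0 where n0: "\<And>n. n \<ge> n0 \<Longrightarrow> \<sigma> n > 0 \<and> (\<beta> n - 1) / \<sigma> n > 1/2"
    by (auto simp: eventually_sequentially)
  \<comment> \<open>The sequence is shifted so that the domination holds at every index and not just
    eventually.\<close>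
  have "(\<lambda>n. integral\<^sup>L lborel (?F (n + n0))) \<longlonglongrightarrow> integral\<^sup>L lborel ?G"
  proof (rule integral_dominated_convergence[where w = ?w])
    show "integrable lborel ?w"
      by (rule integrable_powr_exp_half[OF a])
    show "AE x in lborel. (\<lambda>n. ?F (n + n0) x) \<longlonglongrightarrow> ?G x"
    proof (rule AE_I2)
      fix x :: real
      have "(\<lambda>n. ?F n x) \<longlonglongrightarrow> ?G x"
      proof (cases "0 < x")
        case True
        have "((\<lambda>y. (1 + (- x) / y) powr y) \<longlongrightarrow> exp (- x)) at_top"
          by (rule tendsto_exp_limit_at_top)
        from filterlim_compose[OF this lam]
        have "(\<lambda>n. (1 - x / \<sigma> n) powr \<sigma> n) \<longlonglongrightarrow> exp (- x)"
          by simp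
        \<comment> \<open>The exponent \<open>\<beta> - 1\<close> is written as \<sigma> times a
          factor tending to 1, which reduces the limit to the classical one for the
          exponential.\<close>
        from tendsto_powr[OF this ratio]
        have "(\<lambda>n. ((1 - x / \<sigma> n) powr \<sigma> n) powr ((\<beta> n - 1) / \<sigma> n)) \<longlonglongrightarrow> exp (- x)"
          by simp
        then have "(\<lambda>n. g x * (x powr (a - 1) * ((1 - x / \<sigma> n) powr \<sigma> n) powr ((\<beta> n - 1) / \<sigma> n)))
            \<longlonglongrightarrow> g x * (x powr (a - 1) * exp (- x))"
          by (intro tendsto_intros)
        also have "?this \<longleftrightarrow> ?thesis"
        proof (rule filterlim_cong)
          have "\<forall>\<^sub>F n in sequentially. \<sigma> n > x"
            using lam by (simp add: filterlim_at_top_dense)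
          then show "\<forall>\<^sub>F n in sequentially.
              g x * (x powr (a - 1) * ((1 - x / \<sigma> n) powr \<sigma> n) powr ((\<beta> n - 1) / \<sigma> n)) = ?F n x"
            by eventually_elim (use True in \<open>auto simp: powr_powr\<close>)
        qed (use True in auto)
        finally show ?thesis .
      qed simp
      then show "(\<lambda>n. ?F (n + n0) x) \<longlonglongrightarrow> ?G x"
        by (rule LIMSEQ_ignore_initial_segment)
    qed
    show "AE x in lborel. norm (?F (n + n0) x) \<le> ?w x" for n
    proof (rule AE_I2)
      fix x :: real
      let ?l = "\<sigma> (n + n0)" and ?b = "\<beta> (n + n0) - 1"
      show "norm (?F (n + n0) x) \<le> ?w x"
      proof (cases "0 < x \<and> x < ?l")
        case True
        have l: "0 < ?l" "?b / ?l > 1/2" using n0[of "n + n0"] by auto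
        then have b: "0 < ?b"
          by (metis divide_nonpos_pos half_gt_zero_iff less_eq_real_def linorder_not_less order_less_trans zero_less_one)
        have "1 - x / ?l \<le> exp (- (x / ?l))"
          using exp_ge_add_one_self[of "- (x / ?l)"] by simp
        then have "(1 - x / ?l) powr ?b \<le> exp (- (x / ?l)) powr ?b"
          using True l b by (intro powr_mono2) auto
        also have "\<dots> = exp (- x * (?b / ?l))"
          by (simp add: powr_def)
        also have "\<dots> \<le> exp (- x / 2)"
          using True l mult_left_mono[of "1/2" "?b / ?l" x] by auto
        finally have "(1 - x / ?l) powr ?b \<le> exp (- x / 2)" .
        then have "\<bar>g x\<bar> * (x powr (a - 1) * (1 - x / ?l) powr ?b) \<le> 1 * (x powr (a - 1) * exp (- x / 2))"
          using bdd by (intro mult_mono mult_left_mono) auto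
        then show ?thesis
          using True by (simp add: abs_mult)
      qed (auto simp: indicator_def)
    qed
  qed measurable
  then show ?thesis
    by (rule LIMSEQ_offset)
qed

text \<open>Substitution \<open>x\<close> to \<open>l * x\<close>. The normalizing constant stays on
  the left so that its limit can be taken separately.\<close>

lemma integral_Beta_distr_scale:
  fixes g :: "real \<Rightarrow> real"
  assumes ab: "0 < a" "0 < b" and l: "0 < l" and g [measurable]: "g \<in> borel_measurable borel"
  shows "(l powr a * Beta a b) * (\<integral>x. g (l * x) \<partial>Beta_distr a b)
    = (\<integral>x. g x * (indicator {0<..<l} x * (x powr (a - 1) * (1 - x / l) powr (b - 1))) \<partial>lborel)"
proof -
  have B: "Beta a b \<noteq> 0" using Beta_real_pos[OF ab] by simp
  have "(\<integral>x. g x * (indicator {0<..<l} x * (x powr (a - 1) * (1 - x / l) powr (b - 1))) \<partial>lborel)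
    = l * (\<integral>x. g (0 + l * x) * (indicator {0<..<l} (0 + l * x) *
        ((0 + l * x) powr (a - 1) * (1 - (0 + l * x) / l) powr (b - 1))) \<partial>lborel)"
    using l by (subst lborel_integral_real_affine[of l _ 0]) auto
  also have "\<dots> = (\<integral>x. (l powr a * Beta a b) * (beta_density a b x * g (l * x)) \<partial>lborel)"
    unfolding integral_mult_right_zero[symmetric]
  proof (rule Bochner_Integration.integral_cong[OF refl])
    fix x :: real
    show "l * (g (0 + l * x) * (indicator {0<..<l} (0 + l * x) *
        ((0 + l * x) powr (a - 1) * (1 - (0 + l * x) / l) powr (b - 1))))
      = (l powr a * Beta a b) * (beta_density a b x * g (l * x))"
    proof (cases "0 < x \<and> x < 1")
      case True
      have "l * (l * x) powr (a - 1) = l powr a * x powr (a - 1)"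
        using l True powr_add[of l 1 "a - 1"] by (simp add: powr_mult)
      moreover have "l * x < l" using True l by simp
      ultimately show ?thesis
        using True l B by (simp add: beta_density_def mult_ac)
    next
      case False
      then have "0 + l * x \<notin> {0<..<l}" using l by (auto simp: zero_less_mult_iff)
      then show ?thesis
        using False by (auto simp: beta_density_def)
    qed
  qed
  also have "\<dots> = (l powr a * Beta a b) * (\<integral>x. g (l * x) \<partial>Beta_distr a b)"
    unfolding Beta_distr_def using beta_density_nonneg[OF ab]
    by (subst integral_real_density) auto
  finally show ?thesis ..
qed

text \<open>The constant function 1 has integral 1 under every Beta law, so the limit of the
  unnormalized integrals is that of the normalizing constants.\<close>

lemma Beta_powr_tendsto:
  fixes \<beta> \<sigma> :: "nat \<Rightarrow> real"
  assumes a: "0 < a" and lam: "filterlim \<sigma> at_top sequentially"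
    and ratio: "(\<lambda>n. (\<beta> n - 1) / \<sigma> n) \<longlonglongrightarrow> 1"
    and b: "\<forall>\<^sub>F n in sequentially. 0 < \<beta> n"
  shows "(\<lambda>n. \<sigma> n powr a * Beta a (\<beta> n)) \<longlonglongrightarrow> Gamma a"
proof -
  have "\<forall>\<^sub>F n in sequentially. \<sigma> n > 0"
    using lam by (simp add: filterlim_at_top_dense)
  with b have ev: "\<forall>\<^sub>F n in sequentially.
      (\<integral>x. 1 * (indicator {0<..<\<sigma> n} x * (x powr (a - 1) * (1 - x / \<sigma> n) powr (\<beta> n - 1))) \<partial>lborel)
      = \<sigma> n powr a * Beta a (\<beta> n)"
  proof eventually_elim
    case (elim n)
    interpret real_distribution "Beta_distr a (\<beta> n)"
      by (rule real_distribution_Beta[OF a elim(1)])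
    show ?case
      using prob_space by (subst integral_Beta_distr_scale[OF a elim, symmetric]) auto
  qed
  have "(\<integral>x. 1 * (indicator {0<..} x * (x powr (a - 1) * exp (- x))) \<partial>lborel) = Gamma a"
    using has_bochner_integral_Gamma_integrand[OF a] by (simp add: has_bochner_integral_iff)
  with scaled_beta_integral_tendsto[OF a lam ratio, of "\<lambda>_. 1"] tendsto_cong[OF ev]
  show ?thesis by simp
qed

text \<open>Quotient of the two preceding limits: unnormalized integral over normalizing
  constant.\<close>

lemma Beta_distr_tendsto_Gamma_distr:
  fixes \<beta> \<sigma> :: "nat \<Rightarrow> real" and g :: "real \<Rightarrow> real"
  assumes a: "0 < a" and lam: "filterlim \<sigma> at_top sequentially"
    and ratio: "(\<lambda>n. (\<beta> n - 1) / \<sigma> n) \<longlonglongrightarrow> 1"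
    and b: "\<forall>\<^sub>F n in sequentially. 0 < \<beta> n"
    and g [measurable]: "g \<in> borel_measurable borel" and bdd: "\<And>x. \<bar>g x\<bar> \<le> 1"
  shows "(\<lambda>n. \<integral>x. g (\<sigma> n * x) \<partial>Beta_distr a (\<beta> n)) \<longlonglongrightarrow> (\<integral>x. g x \<partial>Gamma_distr a 1)"
proof -
  let ?I = "\<lambda>n. \<integral>x. g x * (indicator {0<..<\<sigma> n} x * (x powr (a - 1) * (1 - x / \<sigma> n) powr (\<beta> n - 1))) \<partial>lborel"
  have G: "Gamma a \<noteq> 0" using Gamma_real_pos[OF a] by simp
  have "(\<integral>x. g x \<partial>Gamma_distr a 1) = (\<integral>x. gamma_density a 1 x * g x \<partial>lborel)"
    unfolding Gamma_distr_def using gamma_density_nonneg[OF a]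
    by (subst integral_real_density) auto
  also have "\<dots> = (\<integral>x. g x * (indicator {0<..} x * (x powr (a - 1) * exp (- x))) / Gamma a \<partial>lborel)"
    by (intro Bochner_Integration.integral_cong refl) (simp add: gamma_density_def)
  finally have "(\<lambda>n. ?I n / (\<sigma> n powr a * Beta a (\<beta> n))) \<longlonglongrightarrow> (\<integral>x. g x \<partial>Gamma_distr a 1)"
    using tendsto_divide[OF scaled_beta_integral_tendsto[OF a lam ratio g bdd] Beta_powr_tendsto[OF a lam ratio b] G]
    by simp
  moreover have "\<forall>\<^sub>F n in sequentially. \<sigma> n > 0"
    using lam by (simp add: filterlim_at_top_dense)
  with b have "\<forall>\<^sub>F n in sequentially. ?I n / (\<sigma> n powr a * Beta a (\<beta> n)) = (\<integral>x. g (\<sigma> n * x) \<partial>Beta_distr a (\<beta> n))"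
  proof eventually_elim
    case (elim n)
    then have "\<sigma> n powr a * Beta a (\<beta> n) \<noteq> 0"
      using Beta_real_pos[OF a elim(1)] by simp
    then show ?case
      by (subst integral_Beta_distr_scale[OF a elim g, symmetric]) simp
  qed
  ultimately show ?thesis
    by (rule Lim_transform_eventually)
qed

section \<open>Limit laws\<close>

lemma urn_total: "real k / (real k + 1) + (x - 1 + 2 / (real k + 1)) = x + 1 / (real k + 1)"
proof -
  have "real k / (real k + 1) = 1 - 1 / (real k + 1)"
    by (simp add: field_simps)
  moreover have "2 / (real k + 1) = 1 / (real k + 1) + 1 / (real k + 1)"
    by (simp add: add_divide_distrib[symmetric])
  ultimately show ?thesis
    by simp
qed

text \<open>The mixing Beta law does not depend on \<open>n\<close>. At scale \<open>1 / n\<close>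
  the binomial noise has second moment of order \<open>1 / n\<close>, and \<open>(n - j) / n\<close>
  tends to 1.\<close>

lemma Xlaw_beta_limit:
  fixes k j :: nat
  assumes k: "1 \<le> k" and j: "1 \<le> j"
  defines "a \<equiv> k / (real k + 1)" and "b \<equiv> real j - 1 + 2 / (real k + 1)"
  shows "weak_conv_m (\<lambda>n. measure_pmf (map_pmf (\<lambda>x. real x / real n) (Xlaw k n j))) (Beta_distr a b)"
proof (rule weak_conv_m_pmfI)
  have ab: "0 < a" "0 < b"
    using k j unfolding a_def b_def by (auto intro!: add_nonneg_pos divide_pos_pos)
  show "real_distribution (Beta_distr a b)"
    by (rule real_distribution_Beta[OF ab])
  then interpret real_distribution "Beta_distr a b" .
  fix u v :: real assume uv: "u < v"
  let ?f = "cts_step u v"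
  have meas [measurable]: "?f \<in> borel_measurable borel"
    unfolding cts_step_def[abs_def] by measurable
  have frac: "(\<lambda>n. 1 / real n * real (n - j)) \<longlonglongrightarrow> 1"
  proof -
    have "(\<lambda>n. 1 - real j / real n) \<longlonglongrightarrow> 1 - 0"
      by (intro tendsto_intros lim_const_over_n)
    moreover have "\<forall>\<^sub>F n in sequentially. 1 - real j / real n = 1 / real n * real (n - j)"
      using eventually_ge_at_top[of "max 1 j"] by eventually_elim (auto simp: of_nat_diff field_simps)
    ultimately show ?thesis
      by (simp add: tendsto_cong)
  qed
  have inv: "(\<lambda>n. 1 / real n) \<longlonglongrightarrow> 0"
    by (rule lim_const_over_n)
  have "(\<lambda>n. \<Sum>r\<le>n - j. ?f (1 / real n * (1 + real r)) * beta_binomial a b (n - j) r)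
    \<longlonglongrightarrow> integral\<^sup>L (Beta_distr a b) ?f"
  proof (rule beta_binomial_Lipschitz_tendsto[where L = "1 / (v - u)"])
    have "(\<lambda>n. 1 / real n * (1 / real n * real (n - j)) * (a / (a + b))) \<longlonglongrightarrow> 0 * 1 * (a / (a + b))"
      by (intro tendsto_mult tendsto_const inv frac)
    then show "(\<lambda>n. (1 / real n)\<^sup>2 * real (n - j) * (a / (a + b))) \<longlonglongrightarrow> 0"
      by (simp add: power2_eq_square)
    show "(\<lambda>n. \<integral>x. ?f (1 / real n * real (n - j) * x) \<partial>Beta_distr a b) \<longlonglongrightarrow> integral\<^sup>L (Beta_distr a b) ?f"
    proof (rule integral_dominated_convergence[where w = "\<lambda>_. 1"])
      show "AE x in Beta_distr a b. (\<lambda>n. ?f (1 / real n * real (n - j) * x)) \<longlonglongrightarrow> ?f x"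
      proof (rule AE_I2)
        fix x
        have "(\<lambda>n. 1 / real n * real (n - j) * x) \<longlonglongrightarrow> 1 * x"
          by (intro tendsto_mult tendsto_const frac)
        then show "(\<lambda>n. ?f (1 / real n * real (n - j) * x)) \<longlonglongrightarrow> ?f x"
          using isCont_tendsto_compose[OF isCont_cts_step[OF uv, of x]] by simp
      qed
    qed (use cts_step_bounds[OF uv] in auto)
  qed (use ab inv uv cts_step_Lipschitz[OF uv] cts_step_bounds[OF uv] in auto)
  \<comment> \<open>The urn formula describes \<open>Xlaw k n j\<close> from \<open>n = j\<close>
    on, hence an eventual equality.\<close>
  moreover have "\<forall>\<^sub>F n in sequentially.
      (\<Sum>r\<le>n - j. ?f (1 / real n * (1 + real r)) * beta_binomial a b (n - j) r)
      = measure_pmf.expectation (map_pmf (\<lambda>x. real x / real n) (Xlaw k n j)) ?f"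
    using eventually_ge_at_top[of j]
    by eventually_elim (simp add: Xlaw_expectation[OF k j] a_def b_def)
  ultimately show "(\<lambda>n. measure_pmf.expectation (map_pmf (\<lambda>x. real x / real n) (Xlaw k n j)) ?f)
      \<longlonglongrightarrow> integral\<^sup>L (Beta_distr a b) ?f"
    by (rule Lim_transform_eventually)
qed

text \<open>At scale \<open>c = j / n\<close> the Beta variable is multiplied by
  \<open>c * (n - j) = (1 - c) * j\<close>, which tends to infinity and is asymptotic to
  \<open>b n - 1\<close>; this is the regime of the Gamma limit.\<close>

lemma Xlaw_gamma_limit:
  fixes k :: nat and j :: "nat \<Rightarrow> nat"
  assumes k: "1 \<le> k" and jn: "\<And>n. j n \<le> n" and jinf: "filterlim j at_top sequentially"
    and j0: "(\<lambda>n. real (j n) / real n) \<longlonglongrightarrow> 0"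
  defines "a \<equiv> k / (real k + 1)"
  shows "weak_conv_m (\<lambda>n. measure_pmf (map_pmf (\<lambda>x. real (j n) / real n * real x) (Xlaw k n (j n))))
    (Gamma_distr a 1)"
proof (rule weak_conv_m_pmfI)
  define b where "b n = real (j n) - 1 + 2 / (real k + 1)" for n
  let ?c = "\<lambda>n. real (j n) / real n" and ?N = "\<lambda>n. n - j n"
  have a: "0 < a" using k by (simp add: a_def)
  show "real_distribution (Gamma_distr a 1)"
    by (rule real_distribution_Gamma[OF a])
  fix u v :: real assume uv: "u < v"
  let ?f = "cts_step u v"
  have meas [measurable]: "?f \<in> borel_measurable borel"
    unfolding cts_step_def[abs_def] by measurable
  have j1: "\<forall>\<^sub>F n in sequentially. 1 \<le> j n"
    using jinf by (simp add: filterlim_at_top)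
  have rj: "filterlim (\<lambda>n. real (j n)) at_top sequentially"
    by (rule filterlim_compose[OF filterlim_real_sequentially jinf])
  have b: "\<forall>\<^sub>F n in sequentially. 0 < b n"
    using j1 by eventually_elim (auto simp: b_def intro!: add_nonneg_pos)
  have scale: "?c n * real (?N n) = (1 - ?c n) * real (j n)" if "1 \<le> j n" for n
    using that jn[of n] by (simp add: of_nat_diff field_simps)
  have "filterlim (\<lambda>n. (1 - ?c n) * real (j n)) at_top sequentially"
    by (rule filterlim_tendsto_pos_mult_at_top[OF _ _ rj, of _ 1])
       (use tendsto_diff[OF tendsto_const j0, of 1] in auto)
  then have lam: "filterlim (\<lambda>n. ?c n * real (?N n)) at_top sequentially"
    by (rule filterlim_mono_eventually) (use j1 scale in \<open>auto elim!: eventually_mono\<close>)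
  have ratio: "(\<lambda>n. (b n - 1) / (?c n * real (?N n))) \<longlonglongrightarrow> 1"
  proof -
    have "(\<lambda>n. (2 / (real k + 1) - 2) / real (j n)) \<longlonglongrightarrow> 0"
      by (intro real_tendsto_divide_at_top[OF tendsto_const rj])
    then have "(\<lambda>n. (1 + (2 / (real k + 1) - 2) / real (j n)) / (1 - ?c n)) \<longlonglongrightarrow> (1 + 0) / (1 - 0)"
      by (intro tendsto_intros j0) auto
    moreover have "\<forall>\<^sub>F n in sequentially.
        (1 + (2 / (real k + 1) - 2) / real (j n)) / (1 - ?c n) = (b n - 1) / (?c n * real (?N n))"
      using j1
    proof eventually_elim
      case (elim n)
      then have *: "1 + (2 / (real k + 1) - 2) / real (j n) = (b n - 1) / real (j n)"
        by (simp add: b_def diff_divide_distrib add_divide_distrib)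
      show ?case
        unfolding scale[OF elim] * by (simp only: divide_divide_eq_left mult.commute)
    qed
    ultimately show ?thesis
      by (simp add: tendsto_cong)
  qed
  have "(\<lambda>n. \<Sum>r\<le>?N n. ?f (?c n * (1 + real r)) * beta_binomial a (b n) (?N n) r)
    \<longlonglongrightarrow> integral\<^sup>L (Gamma_distr a 1) ?f"
  proof (rule beta_binomial_Lipschitz_tendsto[where L = "1 / (v - u)"])
    show "(\<lambda>n. (?c n)\<^sup>2 * real (?N n) * (a / (a + b n))) \<longlonglongrightarrow> 0"
    \<comment> \<open>The noise term is at most \<open>c\<close>: one factor \<open>c\<close> is set
      aside, \<open>c * (n - j)\<close> is at most \<open>j\<close>, and the mean
      \<open>a / (a + b)\<close> is at most \<open>1 / j\<close>.\<close>
    proof (rule tendsto_sandwich[OF _ _ tendsto_const j0])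
      show "\<forall>\<^sub>F n in sequentially. 0 \<le> (?c n)\<^sup>2 * real (?N n) * (a / (a + b n))"
        using b by eventually_elim (use a in auto)
      show "\<forall>\<^sub>F n in sequentially. (?c n)\<^sup>2 * real (?N n) * (a / (a + b n)) \<le> ?c n"
        using j1
      proof eventually_elim
        case (elim n)
        have n: "0 < n" using elim jn[of n] by linarith
        have "a + b n = real (j n) + 1 / (real k + 1)"
          unfolding a_def b_def by (rule urn_total)
        then have "real (j n) \<le> a + b n" by simp
        moreover have "a \<le> 1" by (simp add: a_def)
        ultimately have "a / (a + b n) \<le> 1 / real (j n)"
          using a elim by (intro frac_le) auto
        moreover have "?c n * real (?N n) \<le> real (j n)"
          unfolding scale[OF elim] by (intro mult_left_le_one_le) (use n jn[of n] in auto)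
        ultimately have "(?c n * real (?N n)) * (a / (a + b n)) \<le> real (j n) * (1 / real (j n))"
          using a elim \<open>real (j n) \<le> a + b n\<close> by (intro mult_mono) auto
        also have "\<dots> = 1" using elim by simp
        finally have "?c n * ((?c n * real (?N n)) * (a / (a + b n))) \<le> ?c n * 1"
          by (intro mult_left_mono) auto
        then show ?case
          by (simp add: power2_eq_square mult.assoc)
      qed
    qed
    show "(\<lambda>n. \<integral>x. ?f (?c n * real (?N n) * x) \<partial>Beta_distr a (b n)) \<longlonglongrightarrow> integral\<^sup>L (Gamma_distr a 1) ?f"
      by (rule Beta_distr_tendsto_Gamma_distr[OF a lam ratio b meas cts_step_bounds[OF uv]])
  qed (use a b j0 uv cts_step_Lipschitz[OF uv] cts_step_bounds[OF uv] in auto)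
  moreover have "\<forall>\<^sub>F n in sequentially.
      (\<Sum>r\<le>?N n. ?f (?c n * (1 + real r)) * beta_binomial a (b n) (?N n) r)
      = measure_pmf.expectation (map_pmf (\<lambda>x. real (j n) / real n * real x) (Xlaw k n (j n))) ?f"
    using j1 by eventually_elim (simp add: Xlaw_expectation[OF k _ jn] a_def b_def)
  ultimately show "(\<lambda>n. measure_pmf.expectation (map_pmf (\<lambda>x. real (j n) / real n * real x) (Xlaw k n (j n))) ?f)
      \<longlonglongrightarrow> integral\<^sup>L (Gamma_distr a 1) ?f"
    by (rule Lim_transform_eventually)
qed

section \<open>Linear \<open>j\<close>: the negative binomial limit\<close>

lemma beta_binomial_0_eq_Beta:
  assumes "0 < a" "0 < b"
  shows "beta_binomial a b N 0 = Beta a (b + N) / Beta a b"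
  using Beta_ratio[OF assms, of 0 N] by (simp add: beta_binomial_def)

text \<open>The mass at 0 is a quotient of Beta values at \<open>b + N\<close> and \<open>b\<close>.
  Both are asymptotic to \<open>Gamma a\<close> times a power, so only the ratio of the powers
  survives.\<close>

lemma beta_binomial_0_tendsto:
  fixes b :: "nat \<Rightarrow> real" and N :: "nat \<Rightarrow> nat"
  assumes a: "0 < a" and b: "filterlim b at_top sequentially" and \<rho>: "0 < \<rho>"
    and ratio: "(\<lambda>n. b n / (b n + N n)) \<longlonglongrightarrow> \<rho>"
  shows "(\<lambda>n. beta_binomial a (b n) (N n) 0) \<longlonglongrightarrow> \<rho> powr a"
proof -
  have scaled: "(\<lambda>n. c n powr a * Beta a (c n)) \<longlonglongrightarrow> Gamma a"
    if c: "filterlim c at_top sequentially" for c :: "nat \<Rightarrow> real"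
  proof (rule Beta_powr_tendsto[OF a c])
    show pos: "\<forall>\<^sub>F n in sequentially. 0 < c n"
      using c by (simp add: filterlim_at_top_dense)
    have "(\<lambda>n. 1 - 1 / c n) \<longlonglongrightarrow> 1 - 0"
      by (intro tendsto_intros real_tendsto_divide_at_top[OF tendsto_const c])
    moreover have "\<forall>\<^sub>F n in sequentially. 1 - 1 / c n = (c n - 1) / c n"
      using pos by eventually_elim (simp add: diff_divide_distrib)
    ultimately show "(\<lambda>n. (c n - 1) / c n) \<longlonglongrightarrow> 1"
      by (simp add: tendsto_cong)
  qed
  have bN: "filterlim (\<lambda>n. b n + N n) at_top sequentially"
    by (rule filterlim_at_top_mono[OF b]) auto
  have G: "Gamma a \<noteq> 0" using Gamma_real_pos[OF a] by simp
  have "(\<lambda>n. ((b n + N n) powr a * Beta a (b n + N n)) / (b n powr a * Beta a (b n)) * (b n / (b n + N n)) powr a)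
      \<longlonglongrightarrow> Gamma a / Gamma a * \<rho> powr a"
    using \<rho> G by (intro tendsto_mult tendsto_divide scaled b bN tendsto_powr ratio tendsto_const) auto
  moreover have "\<forall>\<^sub>F n in sequentially. 0 < b n"
    using b by (simp add: filterlim_at_top_dense)
  then have "\<forall>\<^sub>F n in sequentially.
      ((b n + N n) powr a * Beta a (b n + N n)) / (b n powr a * Beta a (b n)) * (b n / (b n + N n)) powr a
      = beta_binomial a (b n) (N n) 0"
  proof eventually_elim
    case (elim n)
    then show ?case
      by (simp add: beta_binomial_0_eq_Beta[OF a elim] powr_divide)
  qed
  ultimately show ?thesis
    using G by (simp add: tendsto_cong)
qed

lemma beta_binomial_step:
  assumes ab: "0 < a" "0 < b" and m: "m < N"
  shows "beta_binomial a b N (Suc m)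
    = beta_binomial a b N m * ((real N - m) / (b + N - m - 1)) * ((a + m) / (real m + 1))"
proof -
  obtain d where N: "N = Suc m + d"
    using m le_Suc_ex[of "Suc m" N] by auto
  have "Suc m * (N choose Suc m) = (N choose m) * (N - m)"
    using binomial_absorb_comp[of N m] binomial_absorption[of m N]
    by (metis Suc_times_binomial_eq binomial_absorb_comp mult.commute)
  then have "real (Suc m * (N choose Suc m)) = real ((N choose m) * (N - m))"
    by (simp only:)
  then have ch: "real (N choose Suc m) = real (N choose m) * (real N - m) / (real m + 1)"
    using m by (simp add: of_nat_diff field_simps)
  have "b + d \<noteq> 0" using ab by linarith
  have P: "pochhammer b (N - m) = pochhammer b d * (b + d)" "pochhammer a (Suc m) = pochhammer a m * (a + m)"
    by (simp_all add: N pochhammer_rec')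
  have D: "N - Suc m = d" "b + real N - real m - 1 = b + d"
    by (simp_all add: N)
  show ?thesis
    unfolding beta_binomial_def ch P D using \<open>b + d \<noteq> 0\<close> by (simp add: mult_ac)
qed

text \<open>Induction through \<open>beta_binomial_step\<close>: the ratio of consecutive masses
  tends to \<open>(1 - \<rho>) * (a + m) / (m + 1)\<close>, the ratio in the negative binomial
  law.\<close>

lemma beta_binomial_tendsto_negative_binomial:
  fixes b :: "nat \<Rightarrow> real" and N :: "nat \<Rightarrow> nat"
  assumes a: "0 < a" and b: "filterlim b at_top sequentially" and N: "filterlim N at_top sequentially"
    and \<rho>: "0 < \<rho>" and ratio: "(\<lambda>n. b n / (b n + N n)) \<longlonglongrightarrow> \<rho>"
  shows "(\<lambda>n. beta_binomial a (b n) (N n) m) \<longlonglongrightarrow> pochhammer a m / fact m * \<rho> powr a * (1 - \<rho>) ^ m"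
proof (induction m)
  case 0
  then show ?case
    using beta_binomial_0_tendsto[OF a b \<rho> ratio] by simp
next
  case (Suc m)
  have bN: "filterlim (\<lambda>n. b n + N n) at_top sequentially"
    by (rule filterlim_at_top_mono[OF b]) auto
  have bpos: "\<forall>\<^sub>F n in sequentially. 0 < b n"
    using b by (simp add: filterlim_at_top_dense)
  have "\<forall>\<^sub>F n in sequentially. Suc m \<le> N n"
    using N by (simp only: filterlim_at_top)
  then have Nm: "\<forall>\<^sub>F n in sequentially. m < N n"
    by (simp only: Suc_le_eq)
  have "(\<lambda>n. real m / (b n + N n)) \<longlonglongrightarrow> 0" "(\<lambda>n. (real m + 1) / (b n + N n)) \<longlonglongrightarrow> 0"
    by (intro real_tendsto_divide_at_top[OF tendsto_const bN])+
  then have "(\<lambda>n. (1 - b n / (b n + N n) - real m / (b n + N n)) / (1 - (real m + 1) / (b n + N n)))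
      \<longlonglongrightarrow> (1 - \<rho> - 0) / (1 - 0)"
    by (intro tendsto_intros ratio) auto
  moreover have "\<forall>\<^sub>F n in sequentially.
      (1 - b n / (b n + N n) - real m / (b n + N n)) / (1 - (real m + 1) / (b n + N n))
      = (real (N n) - m) / (b n + N n - m - 1)"
    using bpos
  proof eventually_elim
    case (elim n)
    then have nz: "b n + N n \<noteq> 0" by linarith
    then have "1 - b n / (b n + N n) - real m / (b n + N n) = (real (N n) - m) / (b n + N n)"
      and "1 - (real m + 1) / (b n + N n) = (b n + N n - m - 1) / (b n + N n)"
      by (simp_all add: divide_simps)
    then show ?case
      using nz by simp
  qed
  ultimately have lim: "(\<lambda>n. (real (N n) - m) / (b n + N n - m - 1)) \<longlonglongrightarrow> 1 - \<rho>"
    by (simp add: tendsto_cong)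
  have "(\<lambda>n. beta_binomial a (b n) (N n) m * ((real (N n) - m) / (b n + N n - m - 1)) * ((a + m) / (real m + 1)))
      \<longlonglongrightarrow> (pochhammer a m / fact m * \<rho> powr a * (1 - \<rho>) ^ m) * (1 - \<rho>) * ((a + m) / (real m + 1))"
    by (intro tendsto_mult Suc.IH lim tendsto_const)
  moreover have "\<forall>\<^sub>F n in sequentially.
      beta_binomial a (b n) (N n) m * ((real (N n) - m) / (b n + N n - m - 1)) * ((a + m) / (real m + 1))
      = beta_binomial a (b n) (N n) (Suc m)"
    using bpos Nm by eventually_elim (rule beta_binomial_step[OF a, symmetric])
  moreover have "(pochhammer a m / fact m * \<rho> powr a * (1 - \<rho>) ^ m) * (1 - \<rho>) * ((a + m) / (real m + 1))
      = pochhammer a (Suc m) / fact (Suc m) * \<rho> powr a * (1 - \<rho>) ^ Suc m"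
    by (simp add: pochhammer_rec' mult_ac)
  ultimately show ?case
    by (simp add: tendsto_cong)
qed

lemma negbin_pm_eq:
  "negbin_pm k \<rho> m = pochhammer (k / (real k + 1)) m / fact m * \<rho> powr (k / (real k + 1)) * (1 - \<rho>) ^ m"
proof -
  have "real m - 1 / (real k + 1) = real m + k / (real k + 1) - 1"
    by (simp add: field_simps)
  then show ?thesis
    by (simp only: negbin_pm_def gchoose_eq_pochhammer)
qed

lemma finite_nat_le_real: "finite {m. real m \<le> x}"
  by (rule finite_subset[of _ "{..nat \<lfloor>x\<rfloor>}"]) (auto simp: le_nat_floor)

text \<open>Only finitely many naturals lie below \<open>x\<close>, so the \<open>cdf\<close> is a
  finite sum and follows limits of the point masses.\<close>

lemma cdf_negbin_distr:
  assumes "1 \<le> k" "0 < \<rho>" "\<rho> < 1"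
  shows "cdf (negbin_distr k \<rho>) x = (\<Sum>m | real m \<le> x. negbin_pm k \<rho> m)"
proof -
  have nonneg: "0 \<le> negbin_pm k \<rho> m" for m
    unfolding negbin_pm_eq using assms by (intro mult_nonneg_nonneg divide_nonneg_nonneg pochhammer_nonneg) auto
  let ?D = "density (count_space UNIV) (\<lambda>m. ennreal (negbin_pm k \<rho> m))"
  have "emeasure ?D {m. real m \<le> x} = (\<integral>\<^sup>+m. ennreal (negbin_pm k \<rho> m) * indicator {m. real m \<le> x} m \<partial>count_space UNIV)"
    by (rule emeasure_density) auto
  also have "\<dots> = (\<Sum>m | real m \<le> x. ennreal (negbin_pm k \<rho> m) * indicator {m. real m \<le> x} m)"
    by (rule nn_integral_count_space'[OF finite_nat_le_real]) auto
  also have "\<dots> = ennreal (\<Sum>m | real m \<le> x. negbin_pm k \<rho> m)"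
    using nonneg by (subst sum_ennreal[symmetric]) auto
  finally have "measure ?D {m. real m \<le> x} = (\<Sum>m | real m \<le> x. negbin_pm k \<rho> m)"
    unfolding measure_def using nonneg by (simp add: sum_nonneg)
  then show ?thesis
    by (simp add: cdf_def2 negbin_distr_def measure_distr vimage_def)
qed

text \<open>Apart from the shifted indices, the preimage of the half-line can contain only the count
  0, which has probability 0.\<close>

lemma cdf_Xlaw_minus_1:
  assumes "1 \<le> k" "1 \<le> j" "j \<le> n"
  shows "cdf (measure_pmf (map_pmf (\<lambda>x. real x - 1) (Xlaw k n j))) x
    = (\<Sum>m | real m \<le> x. pmf (Xlaw k n j) (Suc m))"
proof -
  let ?A = "(\<lambda>y. real y - 1) -` {..x}"
  have Suc_A: "Suc m \<in> ?A \<longleftrightarrow> real m \<le> x" for m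
    by simp
  have "y \<in> insert 0 (Suc ` {m. real m \<le> x})" if "y \<in> ?A" for y
    using that by (cases y) simp_all
  then have sub: "?A \<subseteq> insert 0 (Suc ` {m. real m \<le> x})" "Suc ` {m. real m \<le> x} \<subseteq> ?A"
    using Suc_A by blast+
  have fin: "finite ?A"
    by (rule finite_subset[OF sub(1)]) (simp add: finite_nat_le_real)
  have "cdf (measure_pmf (map_pmf (\<lambda>x. real x - 1) (Xlaw k n j))) x = sum (pmf (Xlaw k n j)) ?A"
    by (simp add: cdf_def2 measure_measure_pmf_finite[OF fin])
  also have "\<dots> = sum (pmf (Xlaw k n j)) (Suc ` {m. real m \<le> x})"
    using sub pmf_Xlaw_0[OF assms] by (intro sum.mono_neutral_right fin) auto
  also have "\<dots> = (\<Sum>m | real m \<le> x. pmf (Xlaw k n j) (Suc m))"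
    by (subst sum.reindex) auto
  finally show ?thesis .
qed

text \<open>The point masses converge by the urn asymptotics with
  \<open>b n / (b n + (n - j n))\<close> tending to \<rho>; the \<open>cdf\<close>, a finite sum of
  them, then converges at every point.\<close>

lemma Xlaw_negbin_limit:
  fixes k :: nat and j :: "nat \<Rightarrow> nat"
  assumes k: "1 \<le> k" and jn: "\<And>n. j n \<le> n" and jinf: "filterlim j at_top sequentially"
    and \<rho>: "0 < \<rho>" "\<rho> < 1" and j\<rho>: "(\<lambda>n. real (j n) / real n) \<longlonglongrightarrow> \<rho>"
  shows "weak_conv_m (\<lambda>n. measure_pmf (map_pmf (\<lambda>x. real x - 1) (Xlaw k n (j n)))) (negbin_distr k \<rho>)"
proof -
  define a where "a = k / (real k + 1)"
  define s where "s = 2 / (real k + 1) - 1"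
  define b where "b n = real (j n) - 1 + 2 / (real k + 1)" for n
  have a: "0 < a" using k by (simp add: a_def)
  have j1: "\<forall>\<^sub>F n in sequentially. 1 \<le> j n"
    using jinf by (simp add: filterlim_at_top)
  have rj: "filterlim (\<lambda>n. real (j n)) at_top sequentially"
    by (rule filterlim_compose[OF filterlim_real_sequentially jinf])
  have bs: "b n = s + real (j n)" for n
    by (simp add: b_def s_def)
  have b: "filterlim b at_top sequentially"
    unfolding bs by (rule filterlim_tendsto_add_at_top[OF tendsto_const rj])
  have N: "filterlim (\<lambda>n. n - j n) at_top sequentially"
  proof -
    have "filterlim (\<lambda>n. (1 - real (j n) / real n) * real n) at_top sequentially"
      using \<rho> by (intro filterlim_tendsto_pos_mult_at_top[OF tendsto_diff[OF tendsto_const j\<rho>] _ filterlim_real_sequentially]) auto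
    moreover have "\<forall>\<^sub>F n in sequentially. (1 - real (j n) / real n) * real n = real (n - j n)"
      using eventually_gt_at_top[of 0]
      by eventually_elim (use jn in \<open>simp add: of_nat_diff left_diff_distrib\<close>)
    ultimately have "filterlim (\<lambda>n. real (n - j n)) at_top sequentially"
      by (rule filterlim_mono_eventually[OF _ order_refl order_refl])
    then show ?thesis
      by (simp add: filterlim_sequentially_iff_filterlim_real)
  qed
  have ratio: "(\<lambda>n. b n / (b n + real (n - j n))) \<longlonglongrightarrow> \<rho>"
  proof -
    have "(\<lambda>n. (s / real n + real (j n) / real n) / (s / real n + 1)) \<longlonglongrightarrow> (0 + \<rho>) / (0 + 1)"
      by (intro tendsto_intros lim_const_over_n j\<rho>) auto
    moreover have "\<forall>\<^sub>F n in sequentially.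
        (s / real n + real (j n) / real n) / (s / real n + 1) = b n / (b n + real (n - j n))"
      using eventually_gt_at_top[of 0]
    proof eventually_elim
      case (elim n)
      have "b n + real (n - j n) = s + real n"
        using jn[of n] by (simp add: bs of_nat_diff)
      then have "b n / (b n + real (n - j n)) = (b n / real n) / ((s + real n) / real n)"
        using elim by simp
      also have "\<dots> = (s / real n + real (j n) / real n) / (s / real n + 1)"
        using elim by (simp add: bs add_divide_distrib)
      finally show ?case ..
    qed
    ultimately show ?thesis
      by (simp add: tendsto_cong)
  qed
  have "(\<lambda>n. pmf (Xlaw k n (j n)) (Suc m)) \<longlonglongrightarrow> negbin_pm k \<rho> m" for m
  proof -
    have "(\<lambda>n. beta_binomial a (b n) (n - j n) m) \<longlonglongrightarrow> negbin_pm k \<rho> m"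
      unfolding negbin_pm_eq a_def[symmetric]
      by (rule beta_binomial_tendsto_negative_binomial[OF a b N \<rho>(1) ratio])
    moreover have "\<forall>\<^sub>F n in sequentially. beta_binomial a (b n) (n - j n) m = pmf (Xlaw k n (j n)) (Suc m)"
      using j1
    proof eventually_elim
      case (elim n)
      show ?case
        using pmf_Xlaw_beta_binomial[OF k elim, of "n - j n" m] jn[of n] by (simp add: a_def b_def)
    qed
    ultimately show ?thesis
      by (rule Lim_transform_eventually)
  qed
  then have "(\<lambda>n. \<Sum>m | real m \<le> x. pmf (Xlaw k n (j n)) (Suc m)) \<longlonglongrightarrow> cdf (negbin_distr k \<rho>) x" for x
    unfolding cdf_negbin_distr[OF k \<rho>] by (intro tendsto_sum)
  moreover have "\<forall>\<^sub>F n in sequentially. (\<Sum>m | real m \<le> x. pmf (Xlaw k n (j n)) (Suc m))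
      = cdf (measure_pmf (map_pmf (\<lambda>x. real x - 1) (Xlaw k n (j n)))) x" for x
    using j1 by eventually_elim (rule cdf_Xlaw_minus_1[OF k _ jn, symmetric])
  ultimately have "(\<lambda>n. cdf (measure_pmf (map_pmf (\<lambda>x. real x - 1) (Xlaw k n (j n)))) x)
      \<longlonglongrightarrow> cdf (negbin_distr k \<rho>) x" for x
    by (rule Lim_transform_eventually)
  then show ?thesis
    by (simp add: weak_conv_m_def weak_conv_def)
qed

text \<open>A union bound: while no success has occurred, each draw succeeds with probability at
  most \<open>a / (a + b)\<close>, because failures only increase the total weight.\<close>

lemma beta_binomial_0_bounds:
  assumes ab: "0 < a" "0 < b"
  shows "1 - real N * (a / (a + b)) \<le> beta_binomial a b N 0 \<and> 0 \<le> beta_binomial a b N 0 \<and> beta_binomial a b N 0 \<le> 1"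
proof (induction N)
  case 0
  then show ?case by (simp add: beta_binomial_def)
next
  case (Suc N)
  let ?p = "beta_binomial a b N 0"
  have pos: "0 < a + b + N" using ab by linarith
  then have eq: "beta_binomial a b (Suc N) 0 = ?p * ((b + N) / (a + b + N))"
    using beta_binomial_Suc_0[OF ab, of N] by (simp add: field_simps)
  also have "(b + N) / (a + b + N) = 1 - a / (a + b + N)"
    using pos by (simp add: field_simps)
  finally have eq': "beta_binomial a b (Suc N) 0 = ?p - ?p * (a / (a + b + N))"
    by (simp add: right_diff_distrib)
  have "?p * (a / (a + b + N)) \<le> 1 * (a / (a + b))"
    using Suc.IH ab pos by (intro mult_mono divide_left_mono) auto
  moreover have "0 \<le> ?p * (a / (a + b + N))" "0 \<le> ?p * ((b + N) / (a + b + N))"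
    using Suc.IH ab pos by auto
  moreover have "real (Suc N) * (a / (a + b)) = real N * (a / (a + b)) + a / (a + b)"
    by (simp only: of_nat_Suc distrib_right mult_1_left add.commute)
  ultimately show ?case
    using Suc.IH eq eq' by linarith
qed

text \<open>The expected number of successes bounds the probability of having any; it is at most
  \<open>(n - j) / j\<close>, which tends to 0 when \<open>n - j\<close> is small compared with
  \<open>n\<close>.\<close>

lemma Xlaw_degenerate_limit:
  fixes k :: nat and j :: "nat \<Rightarrow> nat"
  assumes k: "1 \<le> k" and jn: "\<And>n. j n \<le> n" and jinf: "filterlim j at_top sequentially"
    and lim: "(\<lambda>n. (real n - real (j n)) / real n) \<longlonglongrightarrow> 0"
  shows "(\<lambda>n. pmf (Xlaw k n (j n)) 1) \<longlonglongrightarrow> 1"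
proof -
  have j1: "\<forall>\<^sub>F n in sequentially. 1 \<le> j n"
    using jinf by (simp add: filterlim_at_top)
  let ?q = "\<lambda>n. (real n - real (j n)) / real n"
  have up: "(\<lambda>n. 1 - ?q n / (1 - ?q n)) \<longlonglongrightarrow> 1 - 0 / (1 - 0)"
    by (intro tendsto_intros lim) auto
  have "\<forall>\<^sub>F n in sequentially. 1 - ?q n / (1 - ?q n) \<le> pmf (Xlaw k n (j n)) 1 \<and> pmf (Xlaw k n (j n)) 1 \<le> 1"
    using j1
  proof eventually_elim
    case (elim n)
    define a where "a = k / (real k + 1)"
    define b where "b = real (j n) - 1 + 2 / (real k + 1)"
    have n: "0 < n" using elim jn[of n] by linarith
    have ab: "0 < a" "0 < b"
      using k elim unfolding a_def b_def by (auto intro!: add_nonneg_pos divide_pos_pos)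
    have "a + b = real (j n) + 1 / (real k + 1)"
      unfolding a_def b_def by (rule urn_total)
    then have "real (j n) \<le> a + b" by simp
    moreover have "a \<le> 1" by (simp add: a_def)
    ultimately have "a / (a + b) \<le> 1 / real (j n)"
      using ab elim by (intro frac_le) auto
    then have "real (n - j n) * (a / (a + b)) \<le> real (n - j n) * (1 / real (j n))"
      by (intro mult_left_mono) auto
    also have "\<dots> = ?q n / (1 - ?q n)"
    proof -
      have "1 - ?q n = real (j n) / real n"
        using n by (simp add: field_simps)
      then show ?thesis
        using n jn[of n] by (simp add: of_nat_diff)
    qed
    finally have "1 - ?q n / (1 - ?q n) \<le> 1 - real (n - j n) * (a / (a + b))" by simp
    moreover have "pmf (Xlaw k n (j n)) 1 = beta_binomial a b (n - j n) 0"
      using pmf_Xlaw_beta_binomial[OF k elim, of "n - j n" 0] jn[of n] by (simp add: a_def b_def)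
    ultimately show ?case
      using beta_binomial_0_bounds[OF ab, of "n - j n"] by linarith
  qed
  then have "\<forall>\<^sub>F n in sequentially. 1 - ?q n / (1 - ?q n) \<le> pmf (Xlaw k n (j n)) 1"
    "\<forall>\<^sub>F n in sequentially. pmf (Xlaw k n (j n)) 1 \<le> 1"
    by (auto elim: eventually_mono)
  then show ?thesis
    by (rule tendsto_sandwich[OF _ _ _ tendsto_const]) (use up in simp)
qed

theorem theorem5:
  fixes k :: nat
  assumes k: "k \<ge> 1"
  shows
    \<comment> \<open>exact distribution\<close>
    "(\<forall>n j m. 1 \<le> j \<and> j \<le> n \<and> 1 \<le> m \<longrightarrow>
       pmf (Xlaw k n j) m =
         gbinom (real m - 1 - 1 / (k + 1)) (int m - 1)
         * gbinom (real n - real m - 1 + 2 / (k + 1)) (int n - int m - int j + 1)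
         / gbinom (real n - k / (k + 1)) (int n - int j))
   \<and> \<comment> \<open>(i) fixed j: Beta limit and its moments\<close>
    (\<forall>j::nat. 1 \<le> j \<longrightarrow>
       weak_conv_m (\<lambda>n. measure_pmf (map_pmf (\<lambda>x. real x / real n) (Xlaw k n j)))
         (Beta_distr (k / (k + 1)) (real j - 1 + 2 / (k + 1)))
       \<and> (\<forall>s::nat. has_bochner_integral (Beta_distr (k / (k + 1)) (real j - 1 + 2 / (k + 1)))
             (\<lambda>x. x ^ s)
             (((real s - 1 / (k + 1)) gchoose s) / ((real s + real j - k / (k + 1)) gchoose s))))
   \<and> \<comment> \<open>(ii) j \<rightarrow> \<infinity>, j = o(n): Gamma limit and its moments\<close>
    (\<forall>j::nat \<Rightarrow> nat. (\<forall>n. j n \<le> n) \<and> filterlim j at_top sequentially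
        \<and> (\<lambda>n. real (j n) / real n) \<longlonglongrightarrow> 0 \<longrightarrow>
       weak_conv_m (\<lambda>n. measure_pmf (map_pmf (\<lambda>x. real (j n) / real n * real x) (Xlaw k n (j n))))
         (Gamma_distr (k / (k + 1)) 1))
   \<and> (\<forall>s::nat. has_bochner_integral (Gamma_distr (k / (k + 1)) 1) (\<lambda>x. x ^ s)
        (fact s * ((real s - 1 / (k + 1)) gchoose s)))
   \<and> \<comment> \<open>(iii) j \<sim> \<rho> n: negative binomial limit of X - 1\<close>
    (\<forall>(\<rho>::real) (j::nat \<Rightarrow> nat). 0 < \<rho> \<and> \<rho> < 1 \<and> (\<forall>n. j n \<le> n) \<and> filterlim j at_top sequentially
        \<and> (\<lambda>n. real (j n) / real n) \<longlonglongrightarrow> \<rho> \<longrightarrow>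
       weak_conv_m (\<lambda>n. measure_pmf (map_pmf (\<lambda>x. real x - 1) (Xlaw k n (j n))))
         (negbin_distr k \<rho>))
   \<and> \<comment> \<open>(iv) n - j = o(n)\<close>
    (\<forall>j::nat \<Rightarrow> nat. (\<forall>n. j n \<le> n) \<and> filterlim j at_top sequentially
        \<and> (\<lambda>n. (real n - real (j n)) / real n) \<longlonglongrightarrow> 0 \<longrightarrow>
       (\<lambda>n. pmf (Xlaw k n (j n)) 1) \<longlonglongrightarrow> 1)"
proof -
  define a where "a = real k / (real k + 1)"
  define b where "b j = real j - 1 + 2 / (real k + 1)" for j
  have K: "real (k + 1) = real k + 1" by simp
  have a: "0 < a" using k by (simp add: a_def)
  have b: "0 < b j" if "1 \<le> j" for j
    using that unfolding b_def by (auto intro!: add_nonneg_pos divide_pos_pos)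
  have a_choose: "(real s - 1 / (real k + 1)) gchoose s = pochhammer a s / fact s" for s
  proof -
    have "real s - 1 / (real k + 1) = real s + a - 1"
      by (simp add: a_def field_simps)
    then show ?thesis
      by (simp only: gchoose_eq_pochhammer)
  qed
  have ab_choose: "(real s + real j - k / (real k + 1)) gchoose s = pochhammer (a + b j) s / fact s" for s j
  proof -
    have "a + b j = real j + 1 / (real k + 1)"
      unfolding a_def b_def by (rule urn_total)
    moreover have "1 / (real k + 1) = 1 - k / (real k + 1)"
      by (simp add: field_simps)
    ultimately have "real s + real j - k / (real k + 1) = real s + (a + b j) - 1"
      by simp
    then show ?thesis
      by (simp only: gchoose_eq_pochhammer)
  qed
  \<comment> \<open>The factorials of the two binomials cancel, leaving the monomial integral with
    exponents \<open>s\<close> and 0.\<close>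
  have beta_moment: "has_bochner_integral (Beta_distr a (b j)) (\<lambda>x. x ^ s)
      (((real s - 1 / (real k + 1)) gchoose s) / ((real s + real j - k / (real k + 1)) gchoose s))"
    if "1 \<le> j" for j s
    using has_bochner_integral_Beta_distr_monom[OF a b[OF that], of s 0]
    unfolding a_choose ab_choose by simp
  have gamma_moment: "has_bochner_integral (Gamma_distr a 1) (\<lambda>x. x ^ s)
      (fact s * ((real s - 1 / (real k + 1)) gchoose s))" for s
    using has_bochner_integral_Gamma_distr_power[OF a, of s] unfolding a_choose by simp
  show ?thesis
  proof (unfold K, intro conjI allI impI; (elim conjE)?)
    fix n j m :: nat assume "1 \<le> j" "j \<le> n" "1 \<le> m"
    from pmf_Xlaw_gbinom[OF k this]
    show "pmf (Xlaw k n j) m = gbinom (real m - 1 - 1 / (real k + 1)) (int m - 1)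
        * gbinom (real n - real m - 1 + 2 / (real k + 1)) (int n - int m - int j + 1)
        / gbinom (real n - k / (real k + 1)) (int n - int j)"
      unfolding K .
  qed (use Xlaw_beta_limit[OF k] Xlaw_gamma_limit[OF k] Xlaw_negbin_limit[OF k]
      Xlaw_degenerate_limit[OF k] beta_moment gamma_moment in \<open>simp_all add: a_def b_def\<close>)
qed

end
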